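(* Consider a cooperative Markov game, a directed acyclic graph $\mathcal G$ on the agents and the tabular softmax Bayesian network (BN) joint policy $\pi_\theta$ (as defined in the context). Let the parameters follow the policy gradient dynamics, performed simultaneously by every agent $i\in\mathcal N$, $$\theta^i_{t+1}=\theta^i_t+\eta\,\nabla_{\theta^i}V_{\theta_t}(\mu),\qquad t=0,1,2,\dots,$$ i.e. $\theta^{i,t+1}_{s,a^{\mathcal P^i},a^i}=\theta^{i,t}_{s,a^{\mathcal P^i},a^i}+\eta\,\partial V_{\theta_t}(\mu)/\partial\theta^i_{s,a^{\mathcal P^i},a^i}$ for all $i,s,a^{\mathcal P^i},a^i$, with a fixed stepsize $0<\eta\le\frac{(1-\gamma)^3}{8N(r_{\max}-r_{\min})}$. Assume: (1) for every joint policy $\pi$ and every state $s$, $d^\pi_\mu(s)>0$; (2) the reward function takes values in $[r_{\min},r_{\max}]$ (so that all values $V_\pi(s)$ lie in some interval $[V_{\min},V_{\max}]$); (3) under the dynamics, the policy of every agent converges: for each $i$ there is a local policy $\pi^i_*$ with $\pi^i_{\theta^i_t}\to\pi^i_*$ as $t\to\infty$. Then the limiting BN policy $(\pi^1_*,\dots,\pi^N_*,\mathcal G)$ is a Nash policy, i.e. for every $i\in\mathcal N$ and every local policy $\bar\pi^i:\mathcal S\times(\times_{j\in\mathcal P^i}\mathcal A^j)\to\Delta(\mathcal A^i)$, replacing $\pi^i_*$ by $\bar\pi^i$ (and keeping the other local policies $\pi^{-i}_*$ and $\mathcal G$) yields $V_{\bar\pi^i,\pi^{-i}_*}(\mu)\le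 V_{\pi_*}(\mu)$.
   Context: Cooperative Markov game $\langle\mathcal N,\mathcal S,\mathcal A,P,r,\mu\rangle$: agents $\mathcal N=\{1,\dots,N\}$; finite state space $\mathcal S$; finite joint action space $\mathcal A=\mathcal A^1\times\cdots\times\mathcal A^N$; transition function $P:\mathcal S\times\mathcal A\to\Delta(\mathcal S)$; shared reward $r:\mathcal S\times\mathcal A\to\mathbb R$; initial state distribution $\mu\in\Delta(\mathcal S)$; discount $\gamma\in[0,1)$; $r_{\min}<r_{\max}$. $\Delta(X)$ is the set of probability distributions on $X$. For a joint policy $\pi:\mathcal S\to\Delta(\mathcal A)$, $V_\pi(s)=\mathbb E_\pi[\sum_{t\ge0}\gamma^t r(s_t,a_t)\mid s_0=s]$ and $V_\pi(\mu)=\mathbb E_{s\sim\mu}[V_\pi(s)]$. The discounted state visitation distribution is $d^\pi_\mu(s)=(1-\gamma)\,\mathbb E_{s_0\sim\mu}\big[\sum_{t\ge0}\gamma^t\Pr^\pi(s_t=s\mid s_0)\big]$. BN policy: $\mathcal G=(\mathcal N,\mathcal E)$ is a directed acyclic graph, $\mathcal P^i=\{j:(i,j)\in\mathcal E\}$ is the set of parents of agent $i$. Local policies are $\pi^i:\mathcal S\times(\times_{j\in\mathcal P^i}\mathcal A^j)\to\Delta(\mathcal A^i)$ and the joint policy is $\pi(a\mid s)=\prod_{i\in\mathcal N}\pi^i(a^i\mid s,a^{\mathcal P^i})$. Tabular softmax parameterization: $\theta^i=\{\theta^i_{s,a^{\mathcal P^i},a^i}\in\mathbb R\}$, $\pi^i_{\theta^i}(a^i\mid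 s,a^{\mathcal P^i})=\exp(\theta^i_{s,a^{\mathcal P^i},a^i})/\sum_{b\in\mathcal A^i}\exp(\theta^i_{s,a^{\mathcal P^i},b})$; $\theta=(\theta^1,\dots,\theta^N)$; $V_\theta:=V_{\pi_\theta}$. *)

theory Defs
  imports "HOL-Probability.Probability"
begin

section \<open>Cooperative Markov games\<close>

text \<open>
  The agents are the elements of a finite type \<open>'n\<close>, so the number of agents is \<open>CARD('n)\<close>;
  the states are the elements of a finite type \<open>'s\<close>. The action sets of different agents may differ;
  they are finite nonempty subsets of a common type \<open>'a\<close>. A joint action is a function
  \<open>a :: 'n \<Rightarrow> 'a\<close> with \<open>a i \<in> acts G i\<close> for all \<open>i\<close>. The values of \<open>trans\<close> and \<open>reward\<close> at functions that
  are not joint actions are irrelevant. A set \<open>\<Delta>(X)\<close> of distributions is rendered by the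
  probability mass functions \<open>p\<close> with \<open>set_pmf p \<subseteq> X\<close>.
\<close>

record ('n, 's, 'a) game =
  acts :: "'n \<Rightarrow> 'a set"
  trans :: "'s \<Rightarrow> ('n \<Rightarrow> 'a) \<Rightarrow> 's pmf"
  reward :: "'s \<Rightarrow> ('n \<Rightarrow> 'a) \<Rightarrow> real"
  init :: "'s pmf"
  disc :: real

definition cooperative_markov_game :: "('n::finite, 's::finite, 'a) game \<Rightarrow> bool" where
  "cooperative_markov_game G \<longleftrightarrow>
     (\<forall>i. finite (acts G i) \<and> acts G i \<noteq> {}) \<and> 0 \<le> disc G \<and> disc G < 1"

definition joint_actions :: "('n, 's, 'a) game \<Rightarrow> ('n \<Rightarrow> 'a) set" where
  "joint_actions G = {a. \<forall>i. a i \<in> acts G i}"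

definition joint_policy :: "('n, 's, 'a) game \<Rightarrow> ('s \<Rightarrow> ('n \<Rightarrow> 'a) pmf) \<Rightarrow> bool" where
  "joint_policy G \<pi> \<longleftrightarrow> (\<forall>s. set_pmf (\<pi> s) \<subseteq> joint_actions G)"


subsection \<open>Trajectories, values and visitation distributions\<close>

text \<open>
  Conditional law of the \<open>t\<close>-th state-action pair \<open>(s\<^sub>t, a\<^sub>t)\<close> given the earlier pairs \<open>\<omega> 0, \<dots>, \<omega> (t - 1)\<close>
  when the game is started in \<open>s\<^sub>0\<close> and the joint policy \<open>\<pi>\<close> is followed.
\<close>

fun step_kernel ::
  "('n, 's, 'a) game \<Rightarrow> ('s \<Rightarrow> ('n \<Rightarrow> 'a) pmf) \<Rightarrow> 's \<Rightarrow>
    nat \<Rightarrow> (nat \<Rightarrow> 's \<times> ('n \<Rightarrow> 'a)) \<Rightarrow> ('s \<times> ('n \<Rightarrow> 'a)) pmf" where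
  "step_kernel G \<pi> s\<^sub>0 0 \<omega> = map_pmf (Pair s\<^sub>0) (\<pi> s\<^sub>0)"
| "step_kernel G \<pi> s\<^sub>0 (Suc t) \<omega> =
     bind_pmf (trans G (fst (\<omega> t)) (snd (\<omega> t))) (\<lambda>s'. map_pmf (Pair s') (\<pi> s'))"

lemma Ionescu_Tulcea_step_kernel:
  fixes G :: "('n, 's, 'a) game"
  shows "Ionescu_Tulcea (\<lambda>t \<omega>. measure_pmf (step_kernel G \<pi> s\<^sub>0 t \<omega>)) (\<lambda>_. count_space UNIV)"
proof
  fix t
  let ?S = "subprob_algebra (count_space (UNIV :: ('s \<times> ('n \<Rightarrow> 'a)) set))"
  show "(\<lambda>\<omega>. measure_pmf (step_kernel G \<pi> s\<^sub>0 t \<omega>)) \<in> PiM {0..<t} (\<lambda>_. count_space UNIV) \<rightarrow>\<^sub>M ?S"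
  proof (cases t)
    case 0
    then show ?thesis
      by (auto intro!: measurable_const simp: space_subprob_algebra measure_pmf.subprob_space_axioms)
  next
    case (Suc k)
    define f where "f = (\<lambda>x. measure_pmf
      (bind_pmf (trans G (fst x) (snd x)) (\<lambda>s'. map_pmf (Pair s') (\<pi> s'))))"
    have f: "f \<in> count_space UNIV \<rightarrow>\<^sub>M ?S"
      by (auto simp: f_def space_subprob_algebra measure_pmf.subprob_space_axioms)
    have "(\<lambda>\<omega>. f (\<omega> k)) \<in> PiM {0..<t} (\<lambda>_. count_space UNIV) \<rightarrow>\<^sub>M ?S"
      by (rule measurable_compose[OF _ f]) (rule measurable_component_singleton, simp add: Suc)
    then show ?thesis
      by (simp add: Suc f_def)
  qed
qed

text \<open>
  The law of the trajectory \<open>(s\<^sub>0, a\<^sub>0), (s\<^sub>1, a\<^sub>1), \<dots>\<close>, given by the Ionescu-Tulcea theorem.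
\<close>

definition trajectory ::
  "('n, 's, 'a) game \<Rightarrow> ('s \<Rightarrow> ('n \<Rightarrow> 'a) pmf) \<Rightarrow> 's \<Rightarrow> (nat \<Rightarrow> 's \<times> ('n \<Rightarrow> 'a)) measure" where
  "trajectory G \<pi> s\<^sub>0 =
     projective_family.lim UNIV
       (Ionescu_Tulcea.CI (\<lambda>t \<omega>. measure_pmf (step_kernel G \<pi> s\<^sub>0 t \<omega>)) (\<lambda>_. count_space UNIV))
       (\<lambda>_. count_space UNIV)"

definition state_value :: "('n, 's, 'a) game \<Rightarrow> ('s \<Rightarrow> ('n \<Rightarrow> 'a) pmf) \<Rightarrow> 's \<Rightarrow> real" where
  "state_value G \<pi> s\<^sub>0 =
     (\<integral>\<omega>. (\<Sum>t. disc G ^ t * reward G (fst (\<omega> t)) (snd (\<omega> t))) \<partial>trajectory G \<pi> s\<^sub>0)"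

definition init_value :: "('n, 's, 'a) game \<Rightarrow> ('s \<Rightarrow> ('n \<Rightarrow> 'a) pmf) \<Rightarrow> real" where
  "init_value G \<pi> = measure_pmf.expectation (init G) (state_value G \<pi>)"

definition visitation :: "('n, 's, 'a) game \<Rightarrow> ('s \<Rightarrow> ('n \<Rightarrow> 'a) pmf) \<Rightarrow> 's \<Rightarrow> real" where
  "visitation G \<pi> s =
     (1 - disc G) *
     measure_pmf.expectation (init G)
       (\<lambda>s\<^sub>0. \<Sum>t. disc G ^ t * measure (trajectory G \<pi> s\<^sub>0) {\<omega>. fst (\<omega> t) = s})"


section \<open>Bayesian network policies\<close>

text \<open>
  A pair \<open>(i, j) \<in> E\<close> means that \<open>j\<close> is a parent of \<open>i\<close>. Joint actions of the parents of \<open>i\<close> are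
  extensional functions on the set of parents, so the parents' part of a joint action \<open>a\<close> is
  \<open>restrict a (parents E i)\<close>.
\<close>

definition parents :: "('n \<times> 'n) set \<Rightarrow> 'n \<Rightarrow> 'n set" where
  "parents E i = {j. (i, j) \<in> E}"

definition contexts :: "('n, 's, 'a) game \<Rightarrow> ('n \<times> 'n) set \<Rightarrow> 'n \<Rightarrow> ('n \<Rightarrow> 'a) set" where
  "contexts G E i = PiE (parents E i) (acts G)"

type_synonym ('n, 's, 'a) lpolicy = "'s \<Rightarrow> ('n \<Rightarrow> 'a) \<Rightarrow> 'a pmf"

definition local_policy ::
  "('n, 's, 'a) game \<Rightarrow> ('n \<times> 'n) set \<Rightarrow> 'n \<Rightarrow> ('n, 's, 'a) lpolicy \<Rightarrow> bool" where
  "local_policy G E i p \<longleftrightarrow> (\<forall>s. \<forall>c\<in>contexts G E i. set_pmf (p s c) \<subseteq> acts G i)"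

definition bn_policy ::
  "('n::finite, 's, 'a) game \<Rightarrow> ('n \<times> 'n) set \<Rightarrow> ('n \<Rightarrow> ('n, 's, 'a) lpolicy) \<Rightarrow>
    's \<Rightarrow> ('n \<Rightarrow> 'a) pmf" where
  "bn_policy G E p s = embed_pmf (\<lambda>a.
     if a \<in> joint_actions G then \<Prod>i\<in>UNIV. pmf (p i s (restrict a (parents E i))) (a i) else 0)"

definition nash_policy ::
  "('n::finite, 's, 'a) game \<Rightarrow> ('n \<times> 'n) set \<Rightarrow> ('n \<Rightarrow> ('n, 's, 'a) lpolicy) \<Rightarrow> bool" where
  "nash_policy G E p \<longleftrightarrow>
     (\<forall>i q. local_policy G E i q \<longrightarrow>
        init_value G (bn_policy G E (p(i := q))) \<le> init_value G (bn_policy G E p))"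


subsection \<open>Tabular softmax parameterization\<close>

text \<open>
  The parameter \<open>\<theta> i s c b\<close> is meaningful for \<open>c \<in> contexts G E i\<close> and \<open>b \<in> acts G i\<close> only.
\<close>

type_synonym ('n, 's, 'a) params = "'n \<Rightarrow> 's \<Rightarrow> ('n \<Rightarrow> 'a) \<Rightarrow> 'a \<Rightarrow> real"

definition softmax ::
  "('n, 's, 'a) game \<Rightarrow> ('n, 's, 'a) params \<Rightarrow> 'n \<Rightarrow> ('n, 's, 'a) lpolicy" where
  "softmax G \<theta> i s c = embed_pmf (\<lambda>b.
     if b \<in> acts G i then exp (\<theta> i s c b) / (\<Sum>b'\<in>acts G i. exp (\<theta> i s c b')) else 0)"

definition param_value ::
  "('n::finite, 's, 'a) game \<Rightarrow> ('n \<times> 'n) set \<Rightarrow> ('n, 's, 'a) params \<Rightarrow> real" where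
  "param_value G E \<theta> = init_value G (bn_policy G E (softmax G \<theta>))"

definition upd_param ::
  "('n, 's, 'a) params \<Rightarrow> 'n \<Rightarrow> 's \<Rightarrow> ('n \<Rightarrow> 'a) \<Rightarrow> 'a \<Rightarrow> real \<Rightarrow> ('n, 's, 'a) params" where
  "upd_param \<theta> i s c b x =
     \<theta>(i := (\<theta> i)(s := (\<theta> i s)(c := (\<theta> i s c)(b := x))))"

definition partial_value ::
  "('n::finite, 's, 'a) game \<Rightarrow> ('n \<times> 'n) set \<Rightarrow> ('n, 's, 'a) params \<Rightarrow>
    'n \<Rightarrow> 's \<Rightarrow> ('n \<Rightarrow> 'a) \<Rightarrow> 'a \<Rightarrow> real" where
  "partial_value G E \<theta> i s c b =
     deriv (\<lambda>x. param_value G E (upd_param \<theta> i s c b x)) (\<theta> i s c b)"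

definition policy_gradient_dynamics ::
  "('n::finite, 's, 'a) game \<Rightarrow> ('n \<times> 'n) set \<Rightarrow> real \<Rightarrow> (nat \<Rightarrow> ('n, 's, 'a) params) \<Rightarrow> bool" where
  "policy_gradient_dynamics G E \<eta> \<theta> \<longleftrightarrow>
     (\<forall>t i s. \<forall>c\<in>contexts G E i. \<forall>b\<in>acts G i.
        \<theta> (Suc t) i s c b = \<theta> t i s c b + \<eta> * partial_value G E (\<theta> t) i s c b)"


section \<open>Well-definedness of the two uses of \<^const>\<open>embed_pmf\<close>\<close>

lemma pmf_embed_pmf_finite:
  fixes f :: "'b \<Rightarrow> real"
  assumes fin: "finite A" and nn: "\<And>x. x \<in> A \<Longrightarrow> 0 \<le> f x" and sum: "sum f A = 1"
  shows "pmf (embed_pmf (\<lambda>x. if x \<in> A then f x else 0)) y = (if y \<in> A then f y else 0)"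
proof (rule pmf_embed_pmf)
  have "(\<integral>\<^sup>+x. ennreal (if x \<in> A then f x else 0) \<partial>count_space UNIV) =
      (\<Sum>x\<in>A. ennreal (if x \<in> A then f x else 0))"
    by (rule nn_integral_count_space'[OF fin]) auto
  also have "\<dots> = (\<Sum>x\<in>A. ennreal (f x))"
    by (rule sum.cong) auto
  also have "\<dots> = ennreal (sum f A)"
    by (rule sum_ennreal) (use nn in auto)
  finally show "(\<integral>\<^sup>+x. ennreal (if x \<in> A then f x else 0) \<partial>count_space UNIV) = 1"
    by (simp add: sum)
qed (use nn in auto)

lemma pmf_softmax:
  assumes "finite (acts G i)" "acts G i \<noteq> {}"
  shows "pmf (softmax G \<theta> i s c) b =
    (if b \<in> acts G i then exp (\<theta> i s c b) / (\<Sum>b'\<in>acts G i. exp (\<theta> i s c b')) else 0)"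
proof -
  have pos: "(\<Sum>b'\<in>acts G i. exp (\<theta> i s c b')) > 0"
    using assms by (intro sum_pos) auto
  show ?thesis
    unfolding softmax_def
    by (rule pmf_embed_pmf_finite)
       (use assms pos in \<open>auto simp: sum_divide_distrib[symmetric] intro!: divide_nonneg_pos\<close>)
qed

lemma sum_bn_closed:
  fixes G :: "('n::finite, 's, 'a) game"
  assumes acyc: "acyclic E"
    and fin: "\<And>i. finite (acts G i)"
    and loc: "\<And>i. local_policy G E i (p i)"
    and closed: "\<And>i. i \<in> J \<Longrightarrow> parents E i \<subseteq> J"
  shows "(\<Sum>a\<in>PiE J (acts G). \<Prod>i\<in>J. pmf (p i s (restrict a (parents E i))) (a i)) = 1"
proof -
  have "finite J" by simp
  then show ?thesis
    using closed
  proof (induction J rule: finite_psubset_induct)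
    case (psubset J)
    show ?case
    proof (cases "J = {}")
      case False
      have "finite E" by (rule finite_subset[OF subset_UNIV]) simp
      then have "wf E" using acyc by (rule finite_acyclic_wf)
      with False obtain k where k: "k \<in> J" and sink: "\<And>j. (j, k) \<in> E \<Longrightarrow> j \<notin> J"
        using wfE_min'[of E J] by blast
      define K where "K = J - {k}"
      have kK: "k \<notin> K" and JK: "J = insert k K" using k by (auto simp: K_def)
      have closedJ: "parents E i \<subseteq> J" if "i \<in> J" for i using psubset.prems that by blast
      have closedK: "parents E i \<subseteq> K" if "i \<in> J" for i
        using closedJ[OF that] sink that by (auto simp: K_def parents_def)
      have IH: "(\<Sum>a\<in>PiE K (acts G). \<Prod>i\<in>K. pmf (p i s (restrict a (parents E i))) (a i)) = 1"
      proof (rule psubset.IH)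
        show "K \<subset> J" using k by (auto simp: K_def)
        show "parents E i \<subseteq> K" if "i \<in> K" for i
          using closedK[of i] that by (simp add: K_def)
      qed
      let ?g = "\<lambda>a. \<Prod>i\<in>J. pmf (p i s (restrict a (parents E i))) (a i)"
      have step: "?g (a(k := b)) =
          pmf (p k s (restrict a (parents E k))) b *
          (\<Prod>i\<in>K. pmf (p i s (restrict a (parents E i))) (a i))" for a b
      proof -
        have r: "restrict (a(k := b)) (parents E i) = restrict a (parents E i)" if "i \<in> J" for i
          using closedK[OF that] kK by (auto simp: restrict_def fun_eq_iff)
        have "?g (a(k := b)) = (\<Prod>i\<in>J. pmf (p i s (restrict a (parents E i))) ((a(k := b)) i))"
          by (rule prod.cong) (auto simp: r)
        also have "\<dots> = pmf (p k s (restrict a (parents E k))) b *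
            (\<Prod>i\<in>K. pmf (p i s (restrict a (parents E i))) ((a(k := b)) i))"
          unfolding JK by (subst prod.insert) (use kK in auto)
        also have "(\<Prod>i\<in>K. pmf (p i s (restrict a (parents E i))) ((a(k := b)) i)) =
            (\<Prod>i\<in>K. pmf (p i s (restrict a (parents E i))) (a i))"
          by (rule prod.cong) (use kK in auto)
        finally show ?thesis .
      qed
      have "(\<Sum>a\<in>PiE J (acts G). ?g a) =
          (\<Sum>(b, a)\<in>acts G k \<times> PiE K (acts G). ?g (a(k := b)))"
        unfolding JK PiE_insert_eq
        by (subst sum.reindex[OF inj_combinator[OF kK]]) (auto simp: case_prod_unfold)
      also have "\<dots> = (\<Sum>a\<in>PiE K (acts G). \<Sum>b\<in>acts G k. ?g (a(k := b)))"
        by (subst sum.swap) (simp add: sum.cartesian_product)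
      also have "\<dots> = (\<Sum>a\<in>PiE K (acts G).
          (\<Prod>i\<in>K. pmf (p i s (restrict a (parents E i))) (a i)))"
      proof (rule sum.cong)
        fix a assume a: "a \<in> PiE K (acts G)"
        have "restrict a (parents E k) \<in> contexts G E k"
          using a closedK[OF k] by (auto simp: contexts_def)
        then have "(\<Sum>b\<in>acts G k. pmf (p k s (restrict a (parents E k))) b) = 1"
          using loc[of k] fin by (auto simp: local_policy_def intro!: sum_pmf_eq_1)
        then show "(\<Sum>b\<in>acts G k. ?g (a(k := b))) =
            (\<Prod>i\<in>K. pmf (p i s (restrict a (parents E i))) (a i))"
          by (simp only: step sum_distrib_right[symmetric] mult_1)
      qed auto
      also note IH
      finally show ?thesis .
    qed simp
  qed
qed

lemma pmf_bn_policy: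
  fixes G :: "('n::finite, 's, 'a) game"
  assumes "acyclic E" "\<And>i. finite (acts G i)" "\<And>i. local_policy G E i (p i)"
  shows "pmf (bn_policy G E p s) a =
    (if a \<in> joint_actions G then \<Prod>i\<in>UNIV. pmf (p i s (restrict a (parents E i))) (a i) else 0)"
proof -
  have eq: "joint_actions G = PiE UNIV (acts G)"
    by (auto simp: joint_actions_def)
  show ?thesis
    unfolding bn_policy_def eq
    by (rule pmf_embed_pmf_finite)
       (use assms sum_bn_closed[of E G p UNIV s] in
         \<open>auto intro!: finite_PiE prod_nonneg\<close>)
qed

end

theory Submission
  imports Defs
begin

text \<open>
  By the performance difference lemma, the partial derivative for agent \<open>i\<close>, state \<open>s\<close>, context \<open>c\<close> and
  action \<open>b\<close> is \<open>d(s) / (1 - \<gamma>) * \<pi>\<^sup>i(b) * U(b)\<close>, where \<open>U(b)\<close> is the advantage of \<open>b\<close> weighted by the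
  probability of \<open>c\<close>. These quantities are continuous in the policy, and by the same lemma the limit is
  a Nash policy if no \<open>U(b)\<close> is positive in the limit.

  Suppose that \<open>U(b)\<close> is positive in the limit. Let \<open>Z\<^sub>t\<close> be the normalizing sum of the softmax at
  \<open>(s, c)\<close>, and \<open>z\<^sub>t = \<eta> d\<^sub>t(s) / ((1 - \<gamma>) Z\<^sub>t)\<close>. One step changes \<open>exp (- \<theta>(b'))\<close> by about \<open>- z\<^sub>t U\<^sub>t(b')\<close>.
  For \<open>b' = b\<close> this forces \<open>\<Sum>z\<^sub>t < \<infinity>\<close>, since \<open>exp (- \<theta>(b))\<close> stays positive. Hence \<open>exp (- \<theta>(b'))\<close> is bounded
  for every \<open>b'\<close>, so all parameters are bounded below. Their sum over \<open>b'\<close> is invariant, so they are bounded,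
  \<open>Z\<^sub>t\<close> is bounded, and \<open>z\<^sub>t\<close> is bounded away from zero, a contradiction.
\<close>

section \<open>Softmax ascent\<close>

text \<open>Isolates the asymptotic argument for one table row. With agent, state and context fixed,
  \<open>x\<close> is the parameter row, \<open>w\<close> the stepsize times the visitation weight,
  \<open>h\<close> the weighted action values. All interaction with other rows is hidden in
  \<open>w\<close> and \<open>h\<close>, which are only assumed to converge, the first to a positive
  limit.\<close>

lemma softmax_ascent_limit:
  fixes B :: "'b set" and x h \<sigma> :: "nat \<Rightarrow> 'b \<Rightarrow> real" and w :: "nat \<Rightarrow> real"
  assumes fin: "finite B"
    and \<sigma>: "\<And>t b. b \<in> B \<Longrightarrow> \<sigma> t b = exp (x t b) / (\<Sum>b'\<in>B. exp (x t b'))"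
    and step: "\<And>t b. b \<in> B \<Longrightarrow> x (Suc t) b = x t b + w t * (\<sigma> t b * (h t b - (\<Sum>b'\<in>B. \<sigma> t b' * h t b')))"
    and w: "w \<longlonglongrightarrow> w'" "0 < w'"
    and \<sigma>_lim: "\<And>b. b \<in> B \<Longrightarrow> (\<lambda>t. \<sigma> t b) \<longlonglongrightarrow> \<sigma>' b"
    and h_lim: "\<And>b. b \<in> B \<Longrightarrow> (\<lambda>t. h t b) \<longlonglongrightarrow> h' b"
    and b: "b \<in> B"
  shows "h' b \<le> (\<Sum>b'\<in>B. \<sigma>' b' * h' b')"
proof (rule ccontr)
  assume "\<not> h' b \<le> (\<Sum>b'\<in>B. \<sigma>' b' * h' b')"
  then have neg: "(\<Sum>b'\<in>B. \<sigma>' b' * h' b') < h' b" by simp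
  define U where "U t b = h t b - (\<Sum>b'\<in>B. \<sigma> t b' * h t b')" for t b
  define U' where "U' b = h' b - (\<Sum>b'\<in>B. \<sigma>' b' * h' b')" for b
  define Z where "Z t = (\<Sum>b\<in>B. exp (x t b))" for t
  define z where "z t = w t / Z t" for t
  define e where "e t b = exp (- x t b)" for t b
  define \<epsilon> where "\<epsilon> = U' b / 2"
  have pos: "0 < U' b" and \<epsilon>: "0 < \<epsilon>"
    using neg by (auto simp: U'_def \<epsilon>_def)
  have Z: "0 < Z t" for t
    unfolding Z_def using fin b by (intro sum_pos) auto
  have \<sigma>_pos: "0 < \<sigma> t b" if "b \<in> B" for t b
    using that Z[of t] by (simp add: \<sigma> Z_def)
  have \<sigma>_sum: "(\<Sum>b\<in>B. \<sigma> t b) = 1" for t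
    using Z[of t] by (simp add: \<sigma> Z_def flip: sum_divide_distrib)
  have \<sigma>_le: "\<sigma> t b \<le> 1" if "b \<in> B" for t b
    using member_le_sum[OF that _ fin, of "\<sigma> t"] \<sigma>_pos by (force simp: \<sigma>_sum less_imp_le)
  have x_Suc: "x (Suc t) b = x t b + w t * (\<sigma> t b * U t b)" if "b \<in> B" for t b
    using step[OF that] by (simp add: U_def)
  have U_lim: "(\<lambda>t. U t b) \<longlonglongrightarrow> U' b" if "b \<in> B" for b
    unfolding U_def U'_def by (intro tendsto_intros h_lim \<sigma>_lim that)
  have "\<exists>K. \<forall>t. \<bar>U t b\<bar> \<le> K" if "b \<in> B" for b
    using convergent_imp_Bseq[OF convergentI[OF U_lim[OF that]]] by (auto simp: Bseq_def)
  then obtain KU where KU: "\<And>b t. b \<in> B \<Longrightarrow> \<bar>U t b\<bar> \<le> KU b" by metis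
  obtain Kw where Kw: "\<And>t. \<bar>w t\<bar> \<le> Kw"
    using convergent_imp_Bseq[OF convergentI[OF w(1)]] by (auto simp: Bseq_def)
  define K where "K = (\<Sum>b\<in>B. \<bar>KU b\<bar>)"
  have K: "\<bar>U t b\<bar> \<le> K" if "b \<in> B" for t b
    using KU[OF that, of t] member_le_sum[OF that _ fin, of "\<lambda>b. \<bar>KU b\<bar>"] by (simp add: K_def)
  have K0: "0 \<le> K" by (simp add: K_def sum_nonneg)
  have Kw0: "0 \<le> Kw" using Kw[of 0] by linarith
  \<comment> \<open>\<open>M\<close> bounds the change of any entry of the row in one step, so the
    exponential estimates below have constants independent of time.\<close>
  define M where "M = Kw * K"
  have M0: "0 \<le> M" using K0 Kw0 by (simp add: M_def)
  have M: "\<bar>w t * (\<sigma> t b * U t b)\<bar> \<le> M" if "b \<in> B" for t b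
  proof -
    have "\<bar>\<sigma> t b * U t b\<bar> \<le> 1 * K"
      unfolding abs_mult using \<sigma>_pos[OF that, of t] \<sigma>_le[OF that, of t] K[OF that, of t] by (intro mult_mono) auto
    then show ?thesis
      unfolding abs_mult[of "w t"] M_def using Kw[of t] by (intro mult_mono) auto
  qed
  have e_pos: "0 < e t b" for t b by (simp add: e_def)
  \<comment> \<open>The factor \<open>exp (- x t b)\<close> cancels the numerator of
    \<open>\<sigma> t b\<close>. What remains, \<open>z t\<close>, is common to all actions, so
    summability of \<open>z\<close> obtained from one action controls the whole row.\<close>
  have e_\<sigma>: "e t b * (w t * (\<sigma> t b * U t b)) = z t * U t b" if "b \<in> B" for t b
    using that Z[of t] by (simp add: e_def \<sigma> z_def Z_def exp_minus field_simps)
  have e_Suc: "e (Suc t) b = e t b * exp (- (w t * (\<sigma> t b * U t b)))" if "b \<in> B" for t b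
    by (simp add: e_def x_Suc[OF that] flip: exp_add)
  have "eventually (\<lambda>t. w' / 2 < w t \<and> \<epsilon> < U t b) sequentially"
    using w \<epsilon> by (intro eventually_conj order_tendstoD(1)[OF w(1)] order_tendstoD(1)[OF U_lim[OF b]])
      (auto simp: \<epsilon>_def)
  then obtain T where T: "\<And>t. T \<le> t \<Longrightarrow> w' / 2 < w t \<and> \<epsilon> < U t b"
    by (auto simp: eventually_sequentially)
  have z_pos: "0 < z t" if "T \<le> t" for t
    using T[OF that] w(2) Z[of t] by (auto simp: z_def intro!: divide_pos_pos)
  \<comment> \<open>The relative drop \<open>1 - exp (- \<Delta>)\<close> is at least
    \<open>\<Delta> / (1 + M)\<close>; multiplication by \<open>e\<close> turns \<Delta> into
    \<open>z t * U t b\<close>.\<close>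
  have dec: "e (Suc t) b \<le> e t b - \<epsilon> / (1 + M) * z t" if "T \<le> t" for t
  proof -
    define \<Delta> where "\<Delta> = w t * (\<sigma> t b * U t b)"
    have \<Delta>: "0 \<le> \<Delta>" "\<Delta> \<le> M"
      using T[OF that] \<epsilon> w(2) \<sigma>_pos[OF b, of t] M[OF b, of t] by (auto simp: \<Delta>_def)
    have "exp (- \<Delta>) \<le> 1 / (1 + \<Delta>)"
      using \<Delta> exp_ge_add_one_self[of \<Delta>] by (simp add: exp_minus field_simps)
    also have "\<dots> = 1 - \<Delta> / (1 + \<Delta>)"
      using \<Delta> by (simp add: field_simps)
    also have "\<dots> \<le> 1 - \<Delta> / (1 + M)"
      using \<Delta> by (simp add: frac_le)
    finally have "e t b * exp (- \<Delta>) \<le> e t b * (1 - \<Delta> / (1 + M))"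
      using e_pos[of t b] by (simp add: mult_left_mono)
    also have "\<dots> = e t b - z t * U t b / (1 + M)"
      unfolding e_\<sigma>[OF b, of t, folded \<Delta>_def, symmetric] by (simp add: right_diff_distrib)
    also have "\<dots> \<le> e t b - z t * \<epsilon> / (1 + M)"
      using T[OF that] z_pos[OF that] M0 by (auto intro!: divide_right_mono)
    finally show ?thesis
      by (simp add: e_Suc[OF b] \<Delta>_def mult.commute)
  qed
  have e_bound: "e (T + n) b + \<epsilon> / (1 + M) * (\<Sum>k<n. z (T + k)) \<le> e T b" for n
  proof (induction n)
    case (Suc n)
    then show ?case using dec[of "T + n"] by (simp add: algebra_simps)
  qed simp
  \<comment> \<open>Since \<open>e\<close> stays positive at the distinguished action, the
    telescoped decreases bound every partial sum of \<open>z\<close> by \<open>S\<close>.\<close>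
  define S where "S = e T b * (1 + M) / \<epsilon>"
  have z_sum: "(\<Sum>k<n. z (T + k)) \<le> S" for n
  proof -
    have "\<epsilon> / (1 + M) * (\<Sum>k<n. z (T + k)) \<le> e T b"
      using e_bound[of n] e_pos[of "T + n" b] by linarith
    then show ?thesis
      using \<epsilon> M0 by (simp add: S_def field_simps)
  qed
  \<comment> \<open>Here \<open>b\<close> is any action and the sign of \<open>U t b\<close> is
    unknown, hence the crude factor \<open>K * exp M\<close>.\<close>
  have inc: "e (Suc t) b \<le> e t b + K * exp M * z t" if "T \<le> t" and b: "b \<in> B" for t b
  proof -
    define \<Delta> where "\<Delta> = w t * (\<sigma> t b * U t b)"
    have \<Delta>: "\<bar>\<Delta>\<bar> \<le> M" using M[OF b] by (simp add: \<Delta>_def)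
    have "exp (- \<Delta>) - 1 \<le> \<bar>\<Delta>\<bar> * exp M"
    proof -
      have "(1 + \<Delta>) * exp (- \<Delta>) \<le> exp \<Delta> * exp (- \<Delta>)"
        by (intro mult_right_mono) auto
      then have "exp (- \<Delta>) - 1 \<le> - \<Delta> * exp (- \<Delta>)"
        by (simp add: algebra_simps flip: exp_add)
      also have "\<dots> \<le> \<bar>\<Delta>\<bar> * exp M"
        using \<Delta> by (intro mult_mono) auto
      finally show ?thesis .
    qed
    then have "e t b * exp (- \<Delta>) \<le> e t b * (1 + \<bar>\<Delta>\<bar> * exp M)"
      using e_pos[of t b] by (intro mult_left_mono) auto
    also have "\<dots> = e t b + \<bar>e t b * \<Delta>\<bar> * exp M"
      using e_pos[of t b] by (simp add: abs_mult algebra_simps)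
    also have "\<bar>e t b * \<Delta>\<bar> = z t * \<bar>U t b\<bar>"
      unfolding \<Delta>_def e_\<sigma>[OF b] using z_pos[OF that(1)] by (simp add: abs_mult)
    also have "e t b + z t * \<bar>U t b\<bar> * exp M \<le> e t b + z t * K * exp M"
      using z_pos[OF that(1)] K[OF b, of t] by (auto intro!: mult_left_mono)
    finally show ?thesis
      by (simp add: e_Suc[OF b] \<Delta>_def mult_ac)
  qed
  have e_le: "e (T + n) b \<le> e T b + K * exp M * S" if b: "b \<in> B" for n b
  proof -
    have "e (T + n) b \<le> e T b + K * exp M * (\<Sum>k<n. z (T + k))"
    proof (induction n)
      case (Suc n)
      then show ?case using inc[of "T + n", OF _ b] by (simp add: algebra_simps)
    qed simp
    also have "\<dots> \<le> e T b + K * exp M * S"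
      using z_sum[of n] K0 by (auto intro!: mult_left_mono)
    finally show ?thesis .
  qed
  define L where "L b = - ln (e T b + K * exp M * S)" for b
  have x_ge: "L b \<le> x (T + n) b" if "b \<in> B" for n b
  proof -
    have "ln (e (T + n) b) \<le> ln (e T b + K * exp M * S)"
      using e_le[OF that, of n] e_pos[of "T + n" b] by (subst ln_le_cancel_iff) linarith+
    then show ?thesis by (simp add: L_def e_def)
  qed
  \<comment> \<open>The \<open>\<sigma>\<close>-average of \<open>U\<close> vanishes because
    \<open>U\<close> is centred, so an update preserves the sum of the row.\<close>
  have x_sum: "(\<Sum>b\<in>B. x t b) = (\<Sum>b\<in>B. x 0 b)" for t
  proof (induction t)
    case (Suc t)
    have "(\<Sum>b\<in>B. \<sigma> t b * U t b) = 0"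
      by (simp add: U_def right_diff_distrib sum_subtractf \<sigma>_sum flip: sum_distrib_right)
    then have "(\<Sum>b\<in>B. x (Suc t) b) = (\<Sum>b\<in>B. x t b)"
      by (simp add: x_Suc sum.distrib flip: sum_distrib_left)
    with Suc show ?case by simp
  qed simp
  \<comment> \<open>An entry is the conserved total minus the other entries, each of which is at
    least \<open>- \<bar>L b\<bar>\<close>.\<close>
  define R where "R = (\<Sum>b\<in>B. x 0 b) + (\<Sum>b\<in>B. \<bar>L b\<bar>)"
  have x_le: "x (T + n) b \<le> R" if b: "b \<in> B" for n b
  proof -
    have "x (T + n) b + (\<Sum>b\<in>B - {b}. - \<bar>L b\<bar>) \<le> x (T + n) b + (\<Sum>b\<in>B - {b}. x (T + n) b)"
      by (intro add_left_mono sum_mono) (use x_ge[of _ n] in force)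
    also have "\<dots> = (\<Sum>b\<in>B. x 0 b)"
      using x_sum[of "T + n"] fin b by (simp add: sum.remove)
    finally have "x (T + n) b \<le> (\<Sum>b\<in>B. x 0 b) + (\<Sum>b\<in>B - {b}. \<bar>L b\<bar>)"
      by (simp add: sum_negf)
    also have "\<dots> \<le> R"
      unfolding R_def using fin by (intro add_left_mono sum_mono2) auto
    finally show ?thesis .
  qed
  \<comment> \<open>The numerator \<open>w' / 2\<close> bounds \<open>w\<close> from below after
    \<open>T\<close>; the denominator bounds \<open>Z\<close> from above because all entries are at
    most \<open>R\<close>.\<close>
  define c where "c = w' / 2 / (card B * exp R)"
  have B0: "0 < card B" using fin b by (auto simp: card_gt_0_iff)
  have c: "0 < c" using w(2) B0 by (simp add: c_def)
  have z_ge: "c \<le> z (T + n)" for n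
  proof -
    have "Z (T + n) \<le> (\<Sum>b\<in>B. exp R)"
      unfolding Z_def by (intro sum_mono) (simp add: x_le)
    then have "Z (T + n) \<le> card B * exp R" by simp
    then show ?thesis
      unfolding c_def z_def using T[of "T + n"] w(2) Z[of "T + n"]
      by (intro frac_le) auto
  qed
  have "real n * c \<le> S" for n
  proof -
    have "real n * c = (\<Sum>k<n. c)" by simp
    also have "\<dots> \<le> (\<Sum>k<n. z (T + k))" by (intro sum_mono z_ge)
    finally show ?thesis using z_sum[of n] by linarith
  qed
  then show False
    using reals_Archimedean3[OF c] by (meson not_less)
qed


section \<open>Laws of state-action pairs\<close>

text \<open>The marginal of the trajectory law at time \<open>t\<close>, built by forward recursion
  so that values become series of expectations over a pmf.\<close>

primrec state_action_law ::
  "('n, 's, 'a) game \<Rightarrow> ('s \<Rightarrow> ('n \<Rightarrow> 'a) pmf) \<Rightarrow> 's \<Rightarrow> nat \<Rightarrow> ('s \<times> ('n \<Rightarrow> 'a)) pmf" where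
  "state_action_law G \<pi> s 0 = map_pmf (Pair s) (\<pi> s)"
| "state_action_law G \<pi> s (Suc t) =
     bind_pmf (state_action_law G \<pi> s t)
       (\<lambda>x. bind_pmf (trans G (fst x) (snd x)) (\<lambda>s'. map_pmf (Pair s') (\<pi> s')))"

text \<open>The limit measure restricts to the law \<open>C 0 (Suc t)\<close> of the first
  \<open>Suc t\<close> pairs, whose last pair is drawn from a kernel that sees only the preceding
  pair.\<close>

lemma nn_integral_trajectory:
  fixes G :: "('n, 's, 'a) game" and g :: "'s \<times> ('n \<Rightarrow> 'a) \<Rightarrow> ennreal"
  shows "(\<integral>\<^sup>+\<omega>. g (\<omega> t) \<partial>trajectory G \<pi> s) = (\<integral>\<^sup>+x. g x \<partial>state_action_law G \<pi> s t)"
proof -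
  interpret Ionescu_Tulcea "\<lambda>t \<omega>. measure_pmf (step_kernel G \<pi> s t \<omega>)" "\<lambda>_. count_space UNIV"
    by (rule Ionescu_Tulcea_step_kernel)
  let ?M = "\<lambda>_::nat. count_space (UNIV :: ('s \<times> ('n \<Rightarrow> 'a)) set)"
  \<comment> \<open>The only history of length zero: an extensional function on the empty index set
    is \<open>undefined\<close> everywhere.\<close>
  let ?u = "(\<lambda>_. undefined) :: nat \<Rightarrow> 's \<times> ('n \<Rightarrow> 'a)"
  have coord: "(\<lambda>\<omega>. h (\<omega> k)) \<in> borel_measurable (PiM J ?M)" if "k \<in> J"
    for h :: "'s \<times> ('n \<Rightarrow> 'a) \<Rightarrow> ennreal" and k J
    by (rule measurable_compose[OF measurable_component_singleton[OF that]]) simp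
  have u: "?u \<in> space (PiM {0..<0} ?M)" by (simp add: space_PiM)
  have step: "(\<integral>\<^sup>+\<omega>. h (\<omega> n) \<partial>C 0 (Suc n) ?u) =
      (\<integral>\<^sup>+\<omega>. (\<integral>\<^sup>+x. h x \<partial>step_kernel G \<pi> s n \<omega>) \<partial>C 0 n ?u)" for h :: "'s \<times> ('n \<Rightarrow> 'a) \<Rightarrow> ennreal" and n
  proof -
    have eP: "eP n \<in> C 0 n ?u \<rightarrow>\<^sub>M subprob_algebra (PiM {0..<Suc n} ?M)"
      by (subst measurable_cong_sets[OF sets_C[OF u] refl]) (use measurable_eP[of n] in simp)
    have "(\<integral>\<^sup>+\<omega>. h (\<omega> n) \<partial>C 0 (Suc n) ?u) = (\<integral>\<^sup>+\<omega>. (\<integral>\<^sup>+\<omega>'. h (\<omega>' n) \<partial>eP n \<omega>) \<partial>C 0 n ?u)"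
      using eP by (simp, subst nn_integral_bind[where B="PiM {0..<Suc n} ?M"]) (auto intro: coord)
    also have "\<dots> = (\<integral>\<^sup>+\<omega>. (\<integral>\<^sup>+x. h x \<partial>step_kernel G \<pi> s n \<omega>) \<partial>C 0 n ?u)"
      using space_C[OF u, of n] by (intro nn_integral_cong) (simp add: nn_integral_eP coord)
    finally show ?thesis .
  qed
  \<comment> \<open>The test function must be arbitrary: the induction step applies the hypothesis
    to the one-step conditional expectation of \<open>h\<close>.\<close>
  have C: "(\<integral>\<^sup>+\<omega>. h (\<omega> n) \<partial>C 0 (Suc n) ?u) = (\<integral>\<^sup>+x. h x \<partial>state_action_law G \<pi> s n)" for h n
  proof (induction n arbitrary: h)
    case 0
    then show ?case
      by (subst step) (simp add: PiM_empty nn_integral_return)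
  next
    case (Suc n)
    show ?case
      using Suc[of "\<lambda>x. \<integral>\<^sup>+s'. (\<integral>\<^sup>+a. h (s', a) \<partial>\<pi> s') \<partial>trans G (fst x) (snd x)"]
      by (subst step) (simp del: C.simps)
  qed
  let ?J = "{0..<Suc t}"
  have up: "up_to ?J = Suc t"
    by (rule antisym) (auto simp: up_to_iff up_to_less Suc_le_eq)
  have res: "(\<lambda>\<omega>. restrict \<omega> ?J) \<in> measurable (PiM K ?M) (PiM ?J ?M)" if "?J \<subseteq> K" for K
    using that by (intro measurable_restrict_subset)
  have "(\<integral>\<^sup>+\<omega>. g (\<omega> t) \<partial>trajectory G \<pi> s) = (\<integral>\<^sup>+\<omega>. g (\<omega> t) \<partial>distr PF.lim (PiM ?J ?M) (\<lambda>\<omega>. restrict \<omega> ?J))"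
    unfolding trajectory_def
    by (subst nn_integral_distr)
       (auto simp: measurable_cong_sets[OF PF.sets_lim refl] intro!: coord res)
  also have "distr PF.lim (PiM ?J ?M) (\<lambda>\<omega>. restrict \<omega> ?J) = CI ?J"
    by (rule distr_lim) simp
  also have "(\<integral>\<^sup>+\<omega>. g (\<omega> t) \<partial>CI ?J) = (\<integral>\<^sup>+\<omega>. g (\<omega> t) \<partial>C 0 (Suc t) ?u)"
    unfolding CI_def up
    by (subst nn_integral_distr)
       (auto simp: measurable_cong_sets[OF sets_C[OF u] refl] simp del: C.simps intro!: coord res)
  also note C
  finally show ?thesis .
qed

lemma measurable_trajectory: "(\<lambda>\<omega>. \<omega> t) \<in> trajectory G \<pi> s \<rightarrow>\<^sub>M count_space UNIV"
proof -
  interpret Ionescu_Tulcea "\<lambda>t \<omega>. measure_pmf (step_kernel G \<pi> s t \<omega>)" "\<lambda>_. count_space UNIV"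
    by (rule Ionescu_Tulcea_step_kernel)
  show ?thesis
    unfolding trajectory_def measurable_cong_sets[OF PF.sets_lim refl]
    by (rule measurable_component_singleton) simp
qed

lemma distr_trajectory:
  "distr (trajectory G \<pi> s) (count_space UNIV) (\<lambda>\<omega>. \<omega> t) = measure_pmf (state_action_law G \<pi> s t)"
proof (rule measure_eqI)
  fix A assume "A \<in> sets (distr (trajectory G \<pi> s) (count_space UNIV) (\<lambda>\<omega>. \<omega> t))"
  have "emeasure (distr (trajectory G \<pi> s) (count_space UNIV) (\<lambda>\<omega>. \<omega> t)) A =
      (\<integral>\<^sup>+x. indicator A x \<partial>distr (trajectory G \<pi> s) (count_space UNIV) (\<lambda>\<omega>. \<omega> t))"
    by simp
  also have "\<dots> = (\<integral>\<^sup>+\<omega>. indicator A (\<omega> t) \<partial>trajectory G \<pi> s)"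
    by (rule nn_integral_distr[OF measurable_trajectory]) simp
  also have "\<dots> = emeasure (state_action_law G \<pi> s t) A"
    by (simp add: nn_integral_trajectory)
  finally show "emeasure (distr (trajectory G \<pi> s) (count_space UNIV) (\<lambda>\<omega>. \<omega> t)) A =
      emeasure (state_action_law G \<pi> s t) A" .
qed simp

lemma expectation_bind_finite:
  fixes h :: "'b \<Rightarrow> real"
  assumes "finite (set_pmf p)" "\<And>x. x \<in> set_pmf p \<Longrightarrow> finite (set_pmf (f x))"
  shows "measure_pmf.expectation (bind_pmf p f) h =
    measure_pmf.expectation p (\<lambda>x. measure_pmf.expectation (f x) h)"
  using assms
  by (subst pmf_expectation_bind[of "set_pmf p"])
     (auto simp: integral_measure_pmf_real[of "set_pmf p"] mult.commute)

lemma expectation_sums: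
  fixes g :: "nat \<Rightarrow> 'b \<Rightarrow> real"
  assumes "finite (set_pmf p)" "\<And>x. x \<in> set_pmf p \<Longrightarrow> (\<lambda>t. g t x) sums S x"
  shows "(\<lambda>t. measure_pmf.expectation p (g t)) sums measure_pmf.expectation p S"
  using assms
  by (subst (1 2) integral_measure_pmf_real[of "set_pmf p"]) (auto intro!: sums_sum sums_mult2)

lemma expectation_finite_type:
  fixes f :: "'b::finite \<Rightarrow> real"
  shows "measure_pmf.expectation p f = (\<Sum>x\<in>UNIV. pmf p x * f x)"
  by (subst integral_measure_pmf_real[of UNIV]) (auto simp: mult.commute)

lemma abs_expectation_le:
  fixes f :: "'b \<Rightarrow> real"
  assumes "finite (set_pmf p)" "\<And>x. x \<in> set_pmf p \<Longrightarrow> \<bar>f x\<bar> \<le> B"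
  shows "\<bar>measure_pmf.expectation p f\<bar> \<le> B"
proof -
  have "\<bar>measure_pmf.expectation p f\<bar> \<le> measure_pmf.expectation p (\<lambda>x. \<bar>f x\<bar>)"
    by simp
  also have "\<dots> \<le> measure_pmf.expectation p (\<lambda>_. B)"
    using assms by (intro integral_mono_AE integrable_measure_pmf_finite) (auto simp: AE_measure_pmf_iff)
  finally show ?thesis by simp
qed

text \<open>\<open>\<rho>\<close> is the law of the state at time \<open>t\<close>; conditionally on
  the state, the action follows the policy.\<close>

lemma state_action_law_eq_bind:
  obtains \<rho> where "state_action_law G \<pi> s t = bind_pmf \<rho> (\<lambda>s'. map_pmf (Pair s') (\<pi> s'))"
proof (cases t)
  case 0
  then show ?thesis using that[of "return_pmf s"] by (simp add: bind_return_pmf)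
next
  case (Suc k)
  then show ?thesis
    using that[of "bind_pmf (state_action_law G \<pi> s k) (\<lambda>x. trans G (fst x) (snd x))"]
    by (simp add: bind_assoc_pmf)
qed

text \<open>The defining recursion appends a step at the end; the Bellman equation needs the first
  step split off instead.\<close>

lemma state_action_law_Suc:
  "state_action_law G \<pi> s (Suc t) =
    bind_pmf (\<pi> s) (\<lambda>a. bind_pmf (trans G s a) (\<lambda>s'. state_action_law G \<pi> s' t))"
  by (induction t) (simp_all add: bind_map_pmf bind_assoc_pmf)


section \<open>Values and the performance difference\<close>

locale finite_markov_game =
  fixes G :: "('n::finite, 's::finite, 'a) game"
  assumes game: "cooperative_markov_game G"
begin

lemma disc: "0 \<le> disc G" "disc G < 1"
  and finite_acts: "finite (acts G i)"
  and acts_nonempty: "acts G i \<noteq> {}"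
  using game by (auto simp: cooperative_markov_game_def)

lemma finite_joint_actions: "finite (joint_actions G)"
proof -
  have "joint_actions G = PiE UNIV (acts G)" by (auto simp: joint_actions_def)
  then show ?thesis by (simp add: finite_PiE finite_acts)
qed

lemma finite_set_policy: "joint_policy G \<pi> \<Longrightarrow> finite (set_pmf (\<pi> s))"
  using finite_joint_actions by (auto simp: joint_policy_def intro: finite_subset)

lemma set_state_action_law:
  assumes "joint_policy G \<pi>"
  shows "set_pmf (state_action_law G \<pi> s t) \<subseteq> UNIV \<times> joint_actions G"
  by (rule state_action_law_eq_bind[of G \<pi> s t]) (use assms in \<open>auto simp: joint_policy_def\<close>)

lemma finite_state_action_law: "joint_policy G \<pi> \<Longrightarrow> finite (set_pmf (state_action_law G \<pi> s t))"
  by (rule finite_subset[OF set_state_action_law]) (simp_all add: finite_joint_actions)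

text \<open>The reward function is a parameter because visitation frequencies are values of indicator functions.\<close>

definition value_of :: "('s \<Rightarrow> ('n \<Rightarrow> 'a) \<Rightarrow> real) \<Rightarrow> ('s \<Rightarrow> ('n \<Rightarrow> 'a) pmf) \<Rightarrow> 's \<Rightarrow> real" where
  "value_of f \<pi> s =
    (\<Sum>t. disc G ^ t * measure_pmf.expectation (state_action_law G \<pi> s t) (\<lambda>x. f (fst x) (snd x)))"

definition q_value ::
  "('s \<Rightarrow> ('n \<Rightarrow> 'a) \<Rightarrow> real) \<Rightarrow> ('s \<Rightarrow> ('n \<Rightarrow> 'a) pmf) \<Rightarrow> 's \<Rightarrow> ('n \<Rightarrow> 'a) \<Rightarrow> real" where
  "q_value f \<pi> s a = f s a + disc G * measure_pmf.expectation (trans G s a) (value_of f \<pi>)"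

lemma joint_action_bound:
  fixes f :: "'s \<Rightarrow> ('n \<Rightarrow> 'a) \<Rightarrow> real"
  obtains B where "0 \<le> B" "\<And>s a. a \<in> joint_actions G \<Longrightarrow> \<bar>f s a\<bar> \<le> B"
proof
  let ?X = "UNIV \<times> joint_actions G :: ('s \<times> ('n \<Rightarrow> 'a)) set"
  show "0 \<le> (\<Sum>(s, a)\<in>?X. \<bar>f s a\<bar>)" by (auto intro: sum_nonneg)
  show "\<bar>f s a\<bar> \<le> (\<Sum>(s, a)\<in>?X. \<bar>f s a\<bar>)" if "a \<in> joint_actions G" for s a
    using member_le_sum[of "(s, a)" ?X "\<lambda>(s, a). \<bar>f s a\<bar>"] that finite_joint_actions by auto
qed

lemma abs_expectation_law_le:
  fixes f :: "'s \<Rightarrow> ('n \<Rightarrow> 'a) \<Rightarrow> real"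
  assumes "joint_policy G \<pi>" "\<And>s a. a \<in> joint_actions G \<Longrightarrow> \<bar>f s a\<bar> \<le> B"
  shows "\<bar>measure_pmf.expectation (state_action_law G \<pi> s t) (\<lambda>x. f (fst x) (snd x))\<bar> \<le> B"
  using set_state_action_law[OF assms(1), of s t] assms(2)
  by (intro abs_expectation_le finite_state_action_law assms(1)) (auto simp: subset_iff)

lemma value_of_sums:
  assumes "joint_policy G \<pi>"
  shows "(\<lambda>t. disc G ^ t * measure_pmf.expectation (state_action_law G \<pi> s t) (\<lambda>x. f (fst x) (snd x)))
    sums value_of f \<pi> s"
  unfolding value_of_def
proof (rule summable_sums)
  obtain B where B: "0 \<le> B" "\<And>s a. a \<in> joint_actions G \<Longrightarrow> \<bar>f s a\<bar> \<le> B"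
    by (rule joint_action_bound[where f=f]) auto
  show "summable (\<lambda>t. disc G ^ t * measure_pmf.expectation (state_action_law G \<pi> s t) (\<lambda>x. f (fst x) (snd x)))"
  proof (rule summable_comparison_test')
    show "summable (\<lambda>t. disc G ^ t * B)"
      using disc by (intro summable_mult2 summable_geometric) simp
    show "norm (disc G ^ t * measure_pmf.expectation (state_action_law G \<pi> s t) (\<lambda>x. f (fst x) (snd x)))
        \<le> disc G ^ t * B" for t
      using abs_expectation_law_le[where f=f and s=s and t=t, OF assms B(2)] disc
      by (simp add: abs_mult mult_left_mono)
  qed
qed

text \<open>Exchanges the integral over trajectories with the series in time, which is dominated by
  a geometric series.\<close>

lemma state_value_eq:
  assumes "joint_policy G \<pi>"
  shows "state_value G \<pi> s = value_of (reward G) \<pi> s"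
proof -
  let ?T = "trajectory G \<pi> s" and ?f = "\<lambda>x. reward G (fst x) (snd x)"
  let ?L = "state_action_law G \<pi> s"
  obtain B where B: "0 \<le> B" "\<And>s a. a \<in> joint_actions G \<Longrightarrow> \<bar>reward G s a\<bar> \<le> B"
    by (rule joint_action_bound[where f="reward G"]) auto
  have law: "integrable ?T (\<lambda>\<omega>. g (\<omega> t))"
    "(\<integral>\<omega>. g (\<omega> t) \<partial>?T) = measure_pmf.expectation (?L t) g" for g :: "_ \<Rightarrow> real" and t
  proof -
    have "integrable (distr ?T (count_space UNIV) (\<lambda>\<omega>. \<omega> t)) g"
      unfolding distr_trajectory by (rule integrable_measure_pmf_finite[OF finite_state_action_law[OF assms]])
    then show "integrable ?T (\<lambda>\<omega>. g (\<omega> t))"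
      by (subst (asm) integrable_distr_eq[OF measurable_trajectory]) auto
    show "(\<integral>\<omega>. g (\<omega> t) \<partial>?T) = measure_pmf.expectation (?L t) g"
      unfolding distr_trajectory[symmetric] by (subst integral_distr[OF measurable_trajectory]) auto
  qed
  \<comment> \<open>At functions that are not joint actions the reward is arbitrary, so the
    geometric majorant is available only off a null set.\<close>
  have "AE \<omega> in ?T. \<forall>t. snd (\<omega> t) \<in> joint_actions G"
    unfolding AE_all_countable
  proof
    fix t
    have "AE x in distr ?T (count_space UNIV) (\<lambda>\<omega>. \<omega> t). snd x \<in> joint_actions G"
      unfolding distr_trajectory AE_measure_pmf_iff using set_state_action_law[OF assms, of s t] by auto
    then show "AE \<omega> in ?T. snd (\<omega> t) \<in> joint_actions G"
      by (subst (asm) AE_distr_iff[OF measurable_trajectory]) auto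
  qed
  then have "AE \<omega> in ?T. summable (\<lambda>t. norm (disc G ^ t * ?f (\<omega> t)))"
  proof eventually_elim
    case (elim \<omega>)
    show ?case
    proof (rule summable_comparison_test')
      show "summable (\<lambda>t. disc G ^ t * B)"
        using disc by (intro summable_mult2 summable_geometric) simp
      show "norm (norm (disc G ^ t * ?f (\<omega> t))) \<le> disc G ^ t * B" for t
        using elim B(2) disc by (simp add: abs_mult mult_left_mono)
    qed
  qed
  \<comment> \<open>The series of expected absolute terms is itself a value, that of the absolute
    reward.\<close>
  moreover have "summable (\<lambda>t. \<integral>\<omega>. norm (disc G ^ t * ?f (\<omega> t)) \<partial>?T)"
  proof (rule sums_summable)
    show "(\<lambda>t. \<integral>\<omega>. norm (disc G ^ t * ?f (\<omega> t)) \<partial>?T) sums value_of (\<lambda>s a. \<bar>reward G s a\<bar>) \<pi> s"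
      using value_of_sums[OF assms, of s "\<lambda>s a. \<bar>reward G s a\<bar>"] disc
      by (simp add: law(2)[of "\<lambda>x. \<bar>?f x\<bar>"] abs_mult)
  qed
  ultimately have "state_value G \<pi> s = (\<Sum>t. \<integral>\<omega>. disc G ^ t * ?f (\<omega> t) \<partial>?T)"
    unfolding state_value_def by (intro integral_suminf) (auto intro: law(1)[of ?f])
  then show ?thesis
    by (simp add: law(2)[of ?f] value_of_def)
qed

section \<open>Discounted occupancy of states\<close>

definition occupancy :: "('s \<Rightarrow> ('n \<Rightarrow> 'a) pmf) \<Rightarrow> 's \<Rightarrow> 's \<Rightarrow> real" where
  "occupancy \<pi> s\<^sub>0 s = value_of (\<lambda>s' a. of_bool (s' = s)) \<pi> s\<^sub>0"

lemma visitation_eq: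
  assumes "joint_policy G \<pi>"
  shows "visitation G \<pi> s = (1 - disc G) * measure_pmf.expectation (init G) (\<lambda>s\<^sub>0. occupancy \<pi> s\<^sub>0 s)"
proof -
  have "measure (trajectory G \<pi> s\<^sub>0) {\<omega>. fst (\<omega> t) = s} =
      measure_pmf.expectation (state_action_law G \<pi> s\<^sub>0 t) (\<lambda>x. of_bool (fst x = s))" for s\<^sub>0 t
  proof -
    have sp: "space (trajectory G \<pi> s\<^sub>0) = UNIV"
    proof -
      interpret Ionescu_Tulcea "\<lambda>t \<omega>. measure_pmf (step_kernel G \<pi> s\<^sub>0 t \<omega>)" "\<lambda>_. count_space UNIV"
        by (rule Ionescu_Tulcea_step_kernel)
      show ?thesis by (simp add: trajectory_def space_PiM)
    qed
    have "measure (trajectory G \<pi> s\<^sub>0) {\<omega>. fst (\<omega> t) = s} =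
        measure (distr (trajectory G \<pi> s\<^sub>0) (count_space UNIV) (\<lambda>\<omega>. \<omega> t)) {x. fst x = s}"
      by (subst measure_distr[OF measurable_trajectory]) (auto simp: sp vimage_def)
    also have "\<dots> = measure_pmf.expectation (state_action_law G \<pi> s\<^sub>0 t) (indicator {x. fst x = s})"
      by (simp add: distr_trajectory)
    also have "indicator {x. fst x = s} = (\<lambda>x::'s \<times> ('n \<Rightarrow> 'a). of_bool (fst x = s) :: real)"
      by (simp add: fun_eq_iff indicator_def)
    finally show ?thesis .
  qed
  then show ?thesis
    by (simp add: visitation_def occupancy_def value_of_def)
qed

lemma expectation_law_occupancy:
  fixes f :: "'s \<Rightarrow> ('n \<Rightarrow> 'a) \<Rightarrow> real"
  assumes "joint_policy G \<pi>"
  shows "measure_pmf.expectation (state_action_law G \<pi> s\<^sub>0 t) (\<lambda>x. f (fst x) (snd x)) =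
    (\<Sum>s\<in>UNIV. measure_pmf.expectation (state_action_law G \<pi> s\<^sub>0 t) (\<lambda>x. of_bool (fst x = s)) *
      measure_pmf.expectation (\<pi> s) (f s))"
proof (rule state_action_law_eq_bind[of G \<pi> s\<^sub>0 t])
  fix \<rho> assume eq: "state_action_law G \<pi> s\<^sub>0 t = bind_pmf \<rho> (\<lambda>s'. map_pmf (Pair s') (\<pi> s'))"
  have E: "measure_pmf.expectation (state_action_law G \<pi> s\<^sub>0 t) g =
      (\<Sum>s\<in>UNIV. pmf \<rho> s * measure_pmf.expectation (\<pi> s) (\<lambda>a. g (s, a)))" for g :: "_ \<Rightarrow> real"
    unfolding eq by (subst expectation_bind_finite)
      (auto simp: finite_set_policy[OF assms] expectation_finite_type)
  have "(\<Sum>s'\<in>UNIV. pmf \<rho> s' * of_bool (s' = s)) = pmf \<rho> s" for s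
    by (simp add: of_bool_def if_distrib[of "\<lambda>x. _ * x"] cong: if_cong)
  then show ?thesis
    by (simp add: E)
qed

text \<open>At each time the expected reward splits over the current state; summing over time first
  leaves the occupancies as weights.\<close>

lemma value_of_occupancy:
  assumes "joint_policy G \<pi>"
  shows "value_of f \<pi> s\<^sub>0 = (\<Sum>s\<in>UNIV. occupancy \<pi> s\<^sub>0 s * measure_pmf.expectation (\<pi> s) (f s))"
proof (rule sums_unique2[OF value_of_sums[OF assms]])
  have "(\<lambda>t. \<Sum>s\<in>UNIV. disc G ^ t * measure_pmf.expectation (state_action_law G \<pi> s\<^sub>0 t)
        (\<lambda>x. of_bool (fst x = s)) * measure_pmf.expectation (\<pi> s) (f s)) sums
      (\<Sum>s\<in>UNIV. occupancy \<pi> s\<^sub>0 s * measure_pmf.expectation (\<pi> s) (f s))"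
    unfolding occupancy_def by (intro sums_sum sums_mult2 value_of_sums assms)
  then show "(\<lambda>t. disc G ^ t * measure_pmf.expectation (state_action_law G \<pi> s\<^sub>0 t)
        (\<lambda>x. f (fst x) (snd x))) sums
      (\<Sum>s\<in>UNIV. occupancy \<pi> s\<^sub>0 s * measure_pmf.expectation (\<pi> s) (f s))"
    by (subst expectation_law_occupancy[OF assms]) (simp add: sum_distrib_left mult.assoc)
qed

text \<open>The upper bound does not depend on the policy, which is what the continuity of values
  rests on.\<close>

lemma occupancy_bounds:
  assumes "joint_policy G \<pi>"
  shows "0 \<le> occupancy \<pi> s\<^sub>0 s" "occupancy \<pi> s\<^sub>0 s \<le> 1 / (1 - disc G)"
proof -
  have s: "(\<lambda>t. disc G ^ t * measure_pmf.expectation (state_action_law G \<pi> s\<^sub>0 t) (\<lambda>x. of_bool (fst x = s)))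
      sums occupancy \<pi> s\<^sub>0 s"
    using value_of_sums[OF assms] unfolding occupancy_def .
  show "0 \<le> occupancy \<pi> s\<^sub>0 s"
    using disc by (intro sums_le[OF _ sums_zero s]) auto
  have "disc G ^ t * measure_pmf.expectation (state_action_law G \<pi> s\<^sub>0 t) (\<lambda>x. of_bool (fst x = s)) \<le> disc G ^ t" for t
  proof -
    have "\<bar>measure_pmf.expectation (state_action_law G \<pi> s\<^sub>0 t) (\<lambda>x. of_bool (fst x = s) :: real)\<bar> \<le> 1"
      by (rule abs_expectation_le[OF finite_state_action_law[OF assms]]) auto
    then show ?thesis using disc by (intro mult_left_le) auto
  qed
  then show "occupancy \<pi> s\<^sub>0 s \<le> 1 / (1 - disc G)"
    using disc by (intro sums_le[OF _ s geometric_sums]) auto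
qed

section \<open>Bellman equation, performance difference and continuity in the policy\<close>

lemma bellman:
  assumes "joint_policy G \<pi>"
  shows "value_of f \<pi> s = measure_pmf.expectation (\<pi> s) (q_value f \<pi> s)"
proof -
  let ?F = "\<lambda>x. f (fst x) (snd x)"
  have "(\<lambda>t. measure_pmf.expectation (\<pi> s) (\<lambda>a. measure_pmf.expectation (trans G s a)
        (\<lambda>s'. disc G ^ t * measure_pmf.expectation (state_action_law G \<pi> s' t) ?F))) sums
      measure_pmf.expectation (\<pi> s) (\<lambda>a. measure_pmf.expectation (trans G s a) (value_of f \<pi>))"
    by (intro expectation_sums value_of_sums assms finite_set_policy) (auto)
  then have "(\<lambda>t. disc G * (disc G ^ t * measure_pmf.expectation (state_action_law G \<pi> s (Suc t)) ?F)) sums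
      (disc G * measure_pmf.expectation (\<pi> s) (\<lambda>a. measure_pmf.expectation (trans G s a) (value_of f \<pi>)))"
    unfolding state_action_law_Suc
    by (intro sums_mult)
       (simp add: expectation_bind_finite finite_set_policy finite_state_action_law assms)
  then have "(\<lambda>t. disc G ^ Suc t * measure_pmf.expectation (state_action_law G \<pi> s (Suc t)) ?F) sums
      (disc G * measure_pmf.expectation (\<pi> s) (\<lambda>a. measure_pmf.expectation (trans G s a) (value_of f \<pi>)))"
    by (simp only: power_Suc mult.assoc)
  \<comment> \<open>\<open>sums_Suc_iff\<close> puts back the term at time 0, the expected immediate
    reward.\<close>
  from sums_unique2[OF value_of_sums[OF assms] iffD1[OF sums_Suc_iff this]] show ?thesis
    by (simp add: q_value_def[abs_def] integrable_measure_pmf_finite finite_set_policy assms)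
qed

text \<open>Along \<open>\<pi>'\<close>, the expected reward is the expected advantage
  \<open>?h\<close> of \<open>\<pi>\<close> plus a telescoping difference of discounted values of
  \<open>\<pi>\<close>. The telescope leaves the value at the start state, and the advantages are
  summed by occupancy. The Bellman equation writes the baseline as a \<open>\<pi>\<close>-average,
  which gives the difference of the two pmfs.\<close>

lemma performance_difference:
  assumes \<pi>: "joint_policy G \<pi>" and \<pi>': "joint_policy G \<pi>'"
  shows "value_of f \<pi>' s\<^sub>0 - value_of f \<pi> s\<^sub>0 =
    (\<Sum>s\<in>UNIV. occupancy \<pi>' s\<^sub>0 s *
      (\<Sum>a\<in>joint_actions G. (pmf (\<pi>' s) a - pmf (\<pi> s) a) * q_value f \<pi> s a))"
proof -
  let ?h = "\<lambda>s a. q_value f \<pi> s a - value_of f \<pi> s"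
  let ?E = "\<lambda>t. measure_pmf.expectation (state_action_law G \<pi>' s\<^sub>0 t)"
  define v where "v t = ?E t (\<lambda>x. value_of f \<pi> (fst x))" for t
  have int: "integrable (measure_pmf (state_action_law G \<pi>' s\<^sub>0 t)) g" for t and g :: "_ \<Rightarrow> real"
    by (rule integrable_measure_pmf_finite[OF finite_state_action_law[OF \<pi>']])
  have v_Suc: "v (Suc t) = ?E t (\<lambda>x. measure_pmf.expectation (trans G (fst x) (snd x)) (value_of f \<pi>))" for t
    unfolding v_def state_action_law.simps
    by (subst expectation_bind_finite[OF finite_state_action_law[OF \<pi>']])
       (simp_all add: expectation_bind_finite finite_set_policy[OF \<pi>'])
  have split: "disc G ^ t * ?E t (\<lambda>x. f (fst x) (snd x)) =
      disc G ^ t * ?E t (\<lambda>x. ?h (fst x) (snd x)) + (disc G ^ t * v t - disc G ^ Suc t * v (Suc t))" for t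
    unfolding v_Suc by (simp add: v_def q_value_def int algebra_simps)
  have v0: "v 0 = value_of f \<pi> s\<^sub>0"
    by (simp add: v_def)
  \<comment> \<open>These are the terms of a convergent series, the value under
    \<open>\<pi>'\<close> for the reward \<open>value_of f \<pi>\<close>.\<close>
  have v_lim: "(\<lambda>t. disc G ^ t * v t) \<longlonglongrightarrow> 0"
    using value_of_sums[OF \<pi>', of s\<^sub>0 "\<lambda>s a. value_of f \<pi> s"]
    unfolding v_def by (intro summable_LIMSEQ_zero) (auto intro: sums_summable)
  have "(\<lambda>t. disc G ^ t * ?E t (\<lambda>x. f (fst x) (snd x))) sums
      (value_of ?h \<pi>' s\<^sub>0 + (disc G ^ 0 * v 0 - 0))"
    unfolding split by (intro sums_add telescope_sums' v_lim value_of_sums[OF \<pi>', of s\<^sub>0 ?h])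
  from sums_unique2[OF value_of_sums[OF \<pi>'] this]
  have "value_of f \<pi>' s\<^sub>0 - value_of f \<pi> s\<^sub>0 = value_of ?h \<pi>' s\<^sub>0"
    by (simp add: v0)
  also have "\<dots> = (\<Sum>s\<in>UNIV. occupancy \<pi>' s\<^sub>0 s * measure_pmf.expectation (\<pi>' s) (?h s))"
    by (rule value_of_occupancy[OF \<pi>'])
  also have "\<dots> = (\<Sum>s\<in>UNIV. occupancy \<pi>' s\<^sub>0 s *
      (\<Sum>a\<in>joint_actions G. (pmf (\<pi>' s) a - pmf (\<pi> s) a) * q_value f \<pi> s a))"
  proof (rule sum.cong)
    fix s
    have E: "measure_pmf.expectation (\<rho> s) (q_value f \<pi> s) =
        (\<Sum>a\<in>joint_actions G. pmf (\<rho> s) a * q_value f \<pi> s a)" if "joint_policy G \<rho>" for \<rho>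
      using that finite_joint_actions
      by (subst integral_measure_pmf_real[of "joint_actions G"]) (auto simp: joint_policy_def mult.commute)
    have "measure_pmf.expectation (\<pi>' s) (?h s) =
        measure_pmf.expectation (\<pi>' s) (q_value f \<pi> s) - measure_pmf.expectation (\<pi> s) (q_value f \<pi> s)"
      using bellman[OF \<pi>, of f s]
      by (simp add: integrable_measure_pmf_finite finite_set_policy \<pi>')
    then show "occupancy \<pi>' s\<^sub>0 s * measure_pmf.expectation (\<pi>' s) (?h s) = occupancy \<pi>' s\<^sub>0 s *
        (\<Sum>a\<in>joint_actions G. (pmf (\<pi>' s) a - pmf (\<pi> s) a) * q_value f \<pi> s a)"
      by (simp add: E \<pi> \<pi>' left_diff_distrib sum_subtractf)
  qed simp
  finally show ?thesis .
qed

text \<open>The performance difference is taken with the limit policy as baseline: the q-values are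
  then fixed, the pmf differences tend to zero, and the varying occupancies need only be bounded.
  The filter is arbitrary because limits in time and limits in a single parameter are both
  needed.\<close>

lemma tendsto_value_of:
  assumes \<pi>: "\<And>x. joint_policy G (\<pi> x)" and \<pi>': "joint_policy G \<pi>'"
    and lim: "\<And>s a. a \<in> joint_actions G \<Longrightarrow> ((\<lambda>x. pmf (\<pi> x s) a) \<longlongrightarrow> pmf (\<pi>' s) a) F"
  shows "((\<lambda>x. value_of f (\<pi> x) s\<^sub>0) \<longlongrightarrow> value_of f \<pi>' s\<^sub>0) F"
proof -
  let ?g = "\<lambda>x s. \<Sum>a\<in>joint_actions G. (pmf (\<pi> x s) a - pmf (\<pi>' s) a) * q_value f \<pi>' s a"
  have "((\<lambda>x. occupancy (\<pi> x) s\<^sub>0 s * ?g x s) \<longlongrightarrow> 0) F" for s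
  proof (rule Lim_null_comparison)
    have "((\<lambda>x. \<bar>?g x s\<bar>) \<longlongrightarrow> \<bar>\<Sum>a\<in>joint_actions G. (pmf (\<pi>' s) a - pmf (\<pi>' s) a) * q_value f \<pi>' s a\<bar>) F"
      by (intro tendsto_intros lim)
    then show "((\<lambda>x. 1 / (1 - disc G) * \<bar>?g x s\<bar>) \<longlongrightarrow> 0) F"
      by (intro tendsto_mult_right_zero) simp
    show "eventually (\<lambda>x. norm (occupancy (\<pi> x) s\<^sub>0 s * ?g x s) \<le> 1 / (1 - disc G) * \<bar>?g x s\<bar>) F"
      unfolding real_norm_def abs_mult using occupancy_bounds[OF \<pi>, of _ s\<^sub>0 s]
      by (intro always_eventually allI mult_right_mono) auto
  qed
  then have "((\<lambda>x. \<Sum>s\<in>UNIV. occupancy (\<pi> x) s\<^sub>0 s * ?g x s) \<longlongrightarrow> 0) F"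
    using tendsto_sum[of UNIV "\<lambda>s x. occupancy (\<pi> x) s\<^sub>0 s * ?g x s" "\<lambda>_. 0" F] by simp
  then have "((\<lambda>x. value_of f (\<pi> x) s\<^sub>0 - value_of f \<pi>' s\<^sub>0) \<longlongrightarrow> 0) F"
    by (simp only: performance_difference[OF \<pi>' \<pi>])
  then show ?thesis by (simp only: Lim_null[symmetric])
qed

lemma init_value_difference:
  assumes \<pi>: "joint_policy G \<pi>" and \<pi>': "joint_policy G \<pi>'"
  shows "init_value G \<pi>' - init_value G \<pi> =
    (\<Sum>s\<in>UNIV. visitation G \<pi>' s / (1 - disc G) *
      (\<Sum>a\<in>joint_actions G. (pmf (\<pi>' s) a - pmf (\<pi> s) a) * q_value (reward G) \<pi> s a))"
    (is "_ = (\<Sum>s\<in>UNIV. _ * ?D s)")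
proof -
  have sv: "state_value G \<rho> = value_of (reward G) \<rho>" if "joint_policy G \<rho>" for \<rho>
    using state_value_eq[OF that] by auto
  have "init_value G \<pi>' - init_value G \<pi> =
      (\<Sum>s\<^sub>0\<in>UNIV. pmf (init G) s\<^sub>0 * (value_of (reward G) \<pi>' s\<^sub>0 - value_of (reward G) \<pi> s\<^sub>0))"
    by (simp add: init_value_def sv \<pi> \<pi>' expectation_finite_type right_diff_distrib sum_subtractf)
  also have "\<dots> = (\<Sum>s\<^sub>0\<in>UNIV. \<Sum>s\<in>UNIV. pmf (init G) s\<^sub>0 * occupancy \<pi>' s\<^sub>0 s * ?D s)"
    by (simp add: performance_difference[OF \<pi> \<pi>'] sum_distrib_left mult.assoc)
  also have "\<dots> = (\<Sum>s\<in>UNIV. \<Sum>s\<^sub>0\<in>UNIV. pmf (init G) s\<^sub>0 * occupancy \<pi>' s\<^sub>0 s * ?D s)"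
    by (rule sum.swap)
  also have "\<dots> = (\<Sum>s\<in>UNIV. visitation G \<pi>' s / (1 - disc G) * ?D s)"
    using disc by (simp add: visitation_eq[OF \<pi>'] expectation_finite_type sum_distrib_right)
  finally show ?thesis .
qed

lemma visitation_nonneg: "joint_policy G \<pi> \<Longrightarrow> 0 \<le> visitation G \<pi> s"
  using disc occupancy_bounds(1) by (simp add: visitation_eq)

lemma tendsto_visitation:
  assumes \<pi>: "\<And>x. joint_policy G (\<pi> x)" and \<pi>': "joint_policy G \<pi>'"
    and lim: "\<And>s a. a \<in> joint_actions G \<Longrightarrow> ((\<lambda>x. pmf (\<pi> x s) a) \<longlongrightarrow> pmf (\<pi>' s) a) F"
  shows "((\<lambda>x. visitation G (\<pi> x) s) \<longlongrightarrow> visitation G \<pi>' s) F"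
  unfolding visitation_eq[OF \<pi>] visitation_eq[OF \<pi>'] expectation_finite_type occupancy_def
  by (intro tendsto_intros tendsto_value_of[OF \<pi> \<pi>'] lim)

lemma tendsto_q_value:
  assumes \<pi>: "\<And>x. joint_policy G (\<pi> x)" and \<pi>': "joint_policy G \<pi>'"
    and lim: "\<And>s a. a \<in> joint_actions G \<Longrightarrow> ((\<lambda>x. pmf (\<pi> x s) a) \<longlongrightarrow> pmf (\<pi>' s) a) F"
  shows "((\<lambda>x. q_value f (\<pi> x) s a) \<longlongrightarrow> q_value f \<pi>' s a) F"
  unfolding q_value_def expectation_finite_type
  by (intro tendsto_intros tendsto_value_of[OF \<pi> \<pi>'] lim)

end


section \<open>Bayesian network policies and their gradients\<close>

locale bn_game = finite_markov_game G
  for G :: "('n::finite, 's::finite, 'a) game" +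
  fixes E :: "('n \<times> 'n) set"
  assumes dag: "acyclic E"
begin

lemma pmf_bn:
  assumes "\<And>i. local_policy G E i (p i)" "a \<in> joint_actions G"
  shows "pmf (bn_policy G E p s) a = (\<Prod>i\<in>UNIV. pmf (p i s (restrict a (parents E i))) (a i))"
  using pmf_bn_policy[OF dag finite_acts assms(1)] assms(2) by simp

lemma joint_policy_bn:
  assumes "\<And>i. local_policy G E i (p i)"
  shows "joint_policy G (bn_policy G E p)"
  using pmf_bn_policy[OF dag finite_acts assms]
  by (auto simp: joint_policy_def set_pmf_iff split: if_splits)

lemma restrict_in_contexts: "a \<in> joint_actions G \<Longrightarrow> restrict a (parents E i) \<in> contexts G E i"
  by (auto simp: joint_actions_def contexts_def)

lemma finite_contexts: "finite (contexts G E i)"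
  unfolding contexts_def by (intro finite_PiE) (auto intro: finite_acts)

text \<open>The action value of agent \<open>i\<close> for the action \<open>b\<close> in the context \<open>c\<close>, multiplied by the
  probability of \<open>c\<close>. Without this weight it would not be continuous at policies
  under which \<open>c\<close> has probability zero.\<close>

definition agent_q ::
  "('n \<Rightarrow> ('n, 's, 'a) lpolicy) \<Rightarrow> 'n \<Rightarrow> 's \<Rightarrow> ('n \<Rightarrow> 'a) \<Rightarrow> 'a \<Rightarrow> real" where
  "agent_q p i s c b =
    (\<Sum>a | a \<in> joint_actions G \<and> (restrict a (parents E i), a i) = (c, b).
      (\<Prod>j\<in>UNIV - {i}. pmf (p j s (restrict a (parents E j))) (a j)) *
      q_value (reward G) (bn_policy G E p) s a)"

text \<open>The factor of agent \<open>i\<close> depends on a joint action only through its context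
  and own action, so joint actions are grouped by this pair. The result is linear in
  \<open>q\<close>.\<close>

lemma sum_bn_agent_q:
  assumes p: "\<And>j. local_policy G E j (p j)" and q: "local_policy G E i q"
  shows "(\<Sum>a\<in>joint_actions G. pmf (bn_policy G E (p(i := q)) s) a *
      q_value (reward G) (bn_policy G E p) s a) =
    (\<Sum>c\<in>contexts G E i. \<Sum>b\<in>acts G i. pmf (q s c) b * agent_q p i s c b)"
proof -
  let ?g = "\<lambda>a. (restrict a (parents E i), a i)"
  let ?Q = "q_value (reward G) (bn_policy G E p) s"
  let ?w = "\<lambda>a. \<Prod>j\<in>UNIV - {i}. pmf (p j s (restrict a (parents E j))) (a j)"
  have loc: "local_policy G E j ((p(i := q)) j)" for j
    using p q by simp
  have w: "pmf (bn_policy G E (p(i := q)) s) a = pmf (q s (restrict a (parents E i))) (a i) * ?w a"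
    if "a \<in> joint_actions G" for a
    by (subst pmf_bn[OF loc that], subst prod.remove[of UNIV i]) auto
  have "(\<Sum>c\<in>contexts G E i. \<Sum>b\<in>acts G i. pmf (q s c) b * agent_q p i s c b) =
      (\<Sum>y\<in>contexts G E i \<times> acts G i. \<Sum>a | a \<in> joint_actions G \<and> ?g a = y.
        pmf (q s (restrict a (parents E i))) (a i) * ?w a * ?Q a)"
    unfolding sum.cartesian_product agent_q_def
    by (rule sum.cong) (auto simp: sum_distrib_left mult.assoc intro!: sum.cong)
  also have "\<dots> = (\<Sum>a\<in>joint_actions G. pmf (q s (restrict a (parents E i))) (a i) * ?w a * ?Q a)"
    by (rule sum.group[OF finite_joint_actions finite_cartesian_product[OF finite_contexts finite_acts]])
       (use restrict_in_contexts in \<open>auto simp: joint_actions_def\<close>)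
  also have "\<dots> = (\<Sum>a\<in>joint_actions G. pmf (bn_policy G E (p(i := q)) s) a * ?Q a)"
    by (simp add: w)
  finally show ?thesis by simp
qed

lemma init_value_bn_difference:
  assumes p: "\<And>j. local_policy G E j (p j)" and q: "local_policy G E i q"
  shows "init_value G (bn_policy G E (p(i := q))) - init_value G (bn_policy G E p) =
    (\<Sum>s\<in>UNIV. visitation G (bn_policy G E (p(i := q))) s / (1 - disc G) *
      (\<Sum>c\<in>contexts G E i. \<Sum>b\<in>acts G i. (pmf (q s c) b - pmf (p i s c) b) * agent_q p i s c b))"
proof -
  have "joint_policy G (bn_policy G E (p(i := q)))"
    by (rule joint_policy_bn) (simp add: p q)
  then show ?thesis
    \<comment> \<open>The second instance takes \<open>q = p i\<close>; since
      \<open>p(i := p i)\<close> is \<open>p\<close>, it yields the baseline.\<close>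
    using sum_bn_agent_q[OF p q] sum_bn_agent_q[OF p p[of i]]
    by (simp add: init_value_difference[OF joint_policy_bn[OF p]]
          left_diff_distrib sum_subtractf)
qed

lemma tendsto_pmf_bn:
  assumes "\<And>x i. local_policy G E i (p x i)" "\<And>i. local_policy G E i (p' i)"
    and "\<And>i s c b. c \<in> contexts G E i \<Longrightarrow> b \<in> acts G i \<Longrightarrow>
      ((\<lambda>x. pmf (p x i s c) b) \<longlongrightarrow> pmf (p' i s c) b) F"
    and a: "a \<in> joint_actions G"
  shows "((\<lambda>x. pmf (bn_policy G E (p x) s) a) \<longlongrightarrow> pmf (bn_policy G E p' s) a) F"
  unfolding pmf_bn[OF assms(1) a] pmf_bn[OF assms(2) a]
  using a by (intro tendsto_prod assms(3) restrict_in_contexts) (auto simp: joint_actions_def)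

lemma tendsto_agent_q:
  assumes p: "\<And>x i. local_policy G E i (p x i)" and p': "\<And>i. local_policy G E i (p' i)"
    and lim: "\<And>i s c b. c \<in> contexts G E i \<Longrightarrow> b \<in> acts G i \<Longrightarrow>
      ((\<lambda>x. pmf (p x i s c) b) \<longlongrightarrow> pmf (p' i s c) b) F"
  shows "((\<lambda>x. agent_q (p x) i s c b) \<longlongrightarrow> agent_q p' i s c b) F"
  unfolding agent_q_def
  by (intro tendsto_sum tendsto_mult tendsto_prod lim
        tendsto_q_value[OF joint_policy_bn[OF p] joint_policy_bn[OF p'] tendsto_pmf_bn[OF p p' lim]]
        restrict_in_contexts)
     (auto simp: joint_actions_def)

section \<open>Softmax parameters and the policy gradient\<close>

lemma local_policy_softmax: "local_policy G E i (softmax G \<theta> i)"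
  using pmf_softmax[OF finite_acts acts_nonempty]
  by (auto simp: local_policy_def set_pmf_iff split: if_splits)

text \<open>Brings the change of one parameter into the form \<open>p(i := q)\<close> of the
  difference formula.\<close>

lemma softmax_upd_param:
  "softmax G (upd_param \<theta> i s c b y) = (softmax G \<theta>)(i := softmax G (upd_param \<theta> i s c b y) i)"
  by (auto simp: fun_eq_iff softmax_def upd_param_def cong: if_cong)

lemma softmax_upd_param_other:
  "s' \<noteq> s \<or> c' \<noteq> c \<Longrightarrow> softmax G (upd_param \<theta> i s c b y) i s' c' = softmax G \<theta> i s' c'"
  by (auto simp: softmax_def upd_param_def cong: if_cong)

lemma DERIV_softmax:
  assumes "b \<in> acts G i"
  shows "((\<lambda>y. pmf (softmax G (upd_param \<theta> i s c b y) i s c) b') has_field_derivative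
    pmf (softmax G \<theta> i s c) b * (of_bool (b' = b) - pmf (softmax G \<theta> i s c) b')) (at (\<theta> i s c b))"
proof (cases "b' \<in> acts G i")
  case True
  let ?x = "\<theta> i s c"
  let ?e = "\<lambda>y b'. exp ((?x(b := y)) b')"
  let ?Z = "\<lambda>y. \<Sum>b'\<in>acts G i. ?e y b'"
  have e: "((\<lambda>y. ?e y b'') has_field_derivative of_bool (b'' = b) * exp (?x b)) (at (?x b))" for b''
    by (cases "b'' = b") (auto intro!: derivative_eq_intros)
  have "(\<Sum>b''\<in>acts G i. of_bool (b'' = b) * exp (?x b)) = exp (?x b)"
    using finite_acts assms by (simp add: of_bool_def if_distrib[of "\<lambda>x. x * _"] cong: if_cong)
  then have Z: "(?Z has_field_derivative exp (?x b)) (at (?x b))"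
    using DERIV_sum[of "acts G i" "\<lambda>y b''. ?e y b''" "\<lambda>b''. of_bool (b'' = b) * exp (?x b)"] e by simp
  have Z0: "0 < (\<Sum>b''\<in>acts G i. exp (?x b''))"
    using finite_acts acts_nonempty by (intro sum_pos) auto
  have "((\<lambda>y. ?e y b' / ?Z y) has_field_derivative
      (of_bool (b' = b) * exp (?x b) * ?Z (?x b) - ?e (?x b) b' * exp (?x b)) / (?Z (?x b) * ?Z (?x b)))
      (at (?x b))"
    using Z0 by (intro DERIV_divide e Z) auto
  moreover have "(of_bool (b' = b) * exp (?x b) * ?Z (?x b) - ?e (?x b) b' * exp (?x b)) / (?Z (?x b) * ?Z (?x b))
      = pmf (softmax G \<theta> i s c) b * (of_bool (b' = b) - pmf (softmax G \<theta> i s c) b')"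
    using True assms Z0 by (simp add: pmf_softmax[OF finite_acts acts_nonempty] field_simps)
  ultimately show ?thesis
    using True by (simp add: pmf_softmax[OF finite_acts acts_nonempty] upd_param_def)
next
  \<comment> \<open>The probability is constantly zero, and \<open>b'\<close> differs from the
    action \<open>b\<close>, so the derivative on the right is zero too.\<close>
  case False
  then show ?thesis
    using assms by (auto simp: pmf_softmax[OF finite_acts acts_nonempty])
qed

text \<open>The exact difference formula writes the increment of the value as
  \<open>?v y * ?g y\<close>, where \<open>?g\<close> vanishes at the base point. The derivative is
  therefore the limit of \<open>?v\<close> times the derivative of \<open>?g\<close>: the visitation
  has to be continuous, but is never differentiated.\<close>

lemma partial_value_eq:
  assumes c: "c \<in> contexts G E i" and b: "b \<in> acts G i"
  shows "partial_value G E \<theta> i s c b =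
    visitation G (bn_policy G E (softmax G \<theta>)) s / (1 - disc G) *
    (pmf (softmax G \<theta> i s c) b *
      (agent_q (softmax G \<theta>) i s c b -
       (\<Sum>b'\<in>acts G i. pmf (softmax G \<theta> i s c) b' * agent_q (softmax G \<theta>) i s c b')))"
  unfolding partial_value_def
proof (rule DERIV_imp_deriv)
  let ?p = "softmax G \<theta>" and ?y = "\<theta> i s c b"
  let ?q = "\<lambda>y. softmax G (upd_param \<theta> i s c b y) i"
  let ?v = "\<lambda>y. visitation G (bn_policy G E (?p(i := ?q y))) s / (1 - disc G)"
  let ?H = "agent_q ?p i s c"
  let ?g = "\<lambda>y. \<Sum>b'\<in>acts G i. (pmf (?q y s c) b' - pmf (?p i s c) b') * ?H b'"
  let ?D = "pmf (?p i s c) b * (?H b - (\<Sum>b'\<in>acts G i. pmf (?p i s c) b' * ?H b'))"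
  have q0: "?q ?y = ?p i"
    by (simp add: upd_param_def)
  \<comment> \<open>Only the row of agent \<open>i\<close> at \<open>s\<close> and \<open>c\<close>
    changes, so the sums over states and contexts collapse to one term.\<close>
  have diff: "param_value G E (upd_param \<theta> i s c b y) - param_value G E \<theta> = ?v y * ?g y" for y
  proof -
    have "param_value G E (upd_param \<theta> i s c b y) - param_value G E \<theta> =
        (\<Sum>s'\<in>UNIV. visitation G (bn_policy G E (?p(i := ?q y))) s' / (1 - disc G) *
          (\<Sum>c'\<in>contexts G E i. \<Sum>b'\<in>acts G i.
            (pmf (?q y s' c') b' - pmf (?p i s' c') b') * agent_q ?p i s' c' b'))"
      unfolding param_value_def
      by (subst softmax_upd_param) (rule init_value_bn_difference[OF local_policy_softmax local_policy_softmax])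
    also have "\<dots> = (\<Sum>s'\<in>UNIV. if s' = s then ?v y * ?g y else 0)"
    proof (rule sum.cong)
      fix s'
      have "(\<Sum>c'\<in>contexts G E i. \<Sum>b'\<in>acts G i.
            (pmf (?q y s' c') b' - pmf (?p i s' c') b') * agent_q ?p i s' c' b') =
          (\<Sum>c'\<in>contexts G E i. if c' = c then (if s' = s then ?g y else 0) else 0)"
        by (rule sum.cong) (auto simp: softmax_upd_param_other)
      then show "visitation G (bn_policy G E (?p(i := ?q y))) s' / (1 - disc G) *
          (\<Sum>c'\<in>contexts G E i. \<Sum>b'\<in>acts G i.
            (pmf (?q y s' c') b' - pmf (?p i s' c') b') * agent_q ?p i s' c' b') =
          (if s' = s then ?v y * ?g y else 0)"
        using c finite_contexts by simp
    qed simp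
    finally show ?thesis by simp
  qed
  have q_lim: "((\<lambda>y. pmf (?q y s' c') b') \<longlongrightarrow> pmf (?p i s' c') b') (at ?y)" for s' c' b'
  proof (cases "s' = s \<and> c' = c")
    case True
    then show ?thesis
      using DERIV_isCont[OF DERIV_softmax[OF b, of \<theta> s c b']] q0 by (simp add: isCont_def)
  next
    case False
    then show ?thesis by (simp add: softmax_upd_param_other)
  qed
  have v_lim: "(?v \<longlongrightarrow> visitation G (bn_policy G E ?p) s / (1 - disc G)) (at ?y)"
  proof (intro tendsto_divide tendsto_const tendsto_visitation joint_policy_bn tendsto_pmf_bn)
    show "local_policy G E j (?p j)" and "local_policy G E j ((?p(i := ?q y)) j)" for j y
      using local_policy_softmax by auto
    then show "local_policy G E j ((?p(i := ?q y)) j)" for j y by simp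
    show "((\<lambda>y. pmf ((?p(i := ?q y)) j s' c') b') \<longlongrightarrow> pmf (?p j s' c') b') (at ?y)" for j s' c' b'
      using q_lim by (cases "j = i") auto
  qed (use disc local_policy_softmax in auto)
  have "(?g has_field_derivative (\<Sum>b'\<in>acts G i.
      pmf (?p i s c) b * (of_bool (b' = b) - pmf (?p i s c) b') * ?H b')) (at ?y)"
    by (intro DERIV_sum) (auto intro!: derivative_eq_intros DERIV_softmax[OF b])
  also have "(\<Sum>b'\<in>acts G i. pmf (?p i s c) b * (of_bool (b' = b) - pmf (?p i s c) b') * ?H b') = ?D"
    using finite_acts b
    by (simp add: mult.assoc left_diff_distrib sum_subtractf of_bool_def
          if_distrib[of "\<lambda>x. x * _"] flip: sum_distrib_left cong: if_cong)
  finally have "((\<lambda>y. (?g y - ?g ?y) / (y - ?y)) \<longlongrightarrow> ?D) (at ?y)"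
    by (simp only: has_field_derivative_iff)
  moreover have "?g ?y = 0"
    by (simp add: q0)
  ultimately have "((\<lambda>y. ?v y * (?g y / (y - ?y))) \<longlongrightarrow>
      visitation G (bn_policy G E ?p) s / (1 - disc G) * ?D) (at ?y)"
    by (intro tendsto_mult v_lim) simp
  moreover have "upd_param \<theta> i s c b ?y = \<theta>"
    by (simp add: upd_param_def)
  ultimately show "((\<lambda>y. param_value G E (upd_param \<theta> i s c b y)) has_field_derivative
      visitation G (bn_policy G E ?p) s / (1 - disc G) * ?D) (at ?y)"
    by (simp only: has_field_derivative_iff diff times_divide_eq_right)
qed

text \<open>The difference formula is exact for arbitrary deviations of one agent and has
  nonnegative weights. It therefore suffices to treat each row separately, where a
  \<open>q\<close>-average of action values cannot exceed their maximum.\<close>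

lemma nash_policyI:
  assumes p: "\<And>i. local_policy G E i (p i)"
    and opt: "\<And>i s c b. c \<in> contexts G E i \<Longrightarrow> b \<in> acts G i \<Longrightarrow>
      agent_q p i s c b \<le> (\<Sum>b'\<in>acts G i. pmf (p i s c) b' * agent_q p i s c b')"
  shows "nash_policy G E p"
  unfolding nash_policy_def
proof (intro allI impI)
  fix i q assume q: "local_policy G E i q"
  have q': "joint_policy G (bn_policy G E (p(i := q)))"
    by (rule joint_policy_bn) (simp add: p q)
  have le: "(\<Sum>b\<in>acts G i. (pmf (q s c) b - pmf (p i s c) b) * agent_q p i s c b) \<le> 0"
    if c: "c \<in> contexts G E i" for s c
  proof -
    let ?m = "\<Sum>b'\<in>acts G i. pmf (p i s c) b' * agent_q p i s c b'"
    have "(\<Sum>b\<in>acts G i. pmf (q s c) b * agent_q p i s c b) \<le> (\<Sum>b\<in>acts G i. pmf (q s c) b * ?m)"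
      by (intro sum_mono mult_left_mono opt c) auto
    also have "\<dots> = ?m"
      using q c finite_acts by (auto simp: local_policy_def sum_pmf_eq_1 simp flip: sum_distrib_right)
    finally show ?thesis
      by (simp add: left_diff_distrib sum_subtractf)
  qed
  have "init_value G (bn_policy G E (p(i := q))) - init_value G (bn_policy G E p) \<le> 0"
    unfolding init_value_bn_difference[OF p q]
    using disc visitation_nonneg[OF q']
    by (intro sum_nonpos[of UNIV] mult_nonneg_nonpos sum_nonpos[of "contexts G E i"] le) auto
  then show "init_value G (bn_policy G E (p(i := q))) \<le> init_value G (bn_policy G E p)"
    by simp
qed

end

section \<open>Limits of the gradient dynamics are Nash policies\<close>

theorem theorem5p5:
  fixes G :: "('n::finite, 's::finite, 'a) game"
    and E :: "('n \<times> 'n) set"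
    and \<theta> :: "nat \<Rightarrow> ('n, 's, 'a) params"
    and \<eta> r_min r_max :: real
    and \<pi>\<^sub>s :: "'n \<Rightarrow> ('n, 's, 'a) lpolicy"
  assumes game: "cooperative_markov_game G"
    and dag: "acyclic E"
    and bounds: "r_min < r_max"
    and stepsize: "0 < \<eta>"
      "\<eta> \<le> (1 - disc G) ^ 3 / (8 * real CARD('n) * (r_max - r_min))"
    and dynamics: "policy_gradient_dynamics G E \<eta> \<theta>"
    and visits: "\<And>\<pi> s. joint_policy G \<pi> \<Longrightarrow> 0 < visitation G \<pi> s"
    and reward: "\<And>s a. a \<in> joint_actions G \<Longrightarrow> reward G s a \<in> {r_min..r_max}"
    and limit_policy: "\<And>i. local_policy G E i (\<pi>\<^sub>s i)"
    and limit: "\<And>i s c b. c \<in> contexts G E i \<Longrightarrow> b \<in> acts G i \<Longrightarrow>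
      (\<lambda>t. pmf (softmax G (\<theta> t) i s c) b) \<longlonglongrightarrow> pmf (\<pi>\<^sub>s i s c) b"
  shows "nash_policy G E \<pi>\<^sub>s"
proof -
  interpret bn_game G E
    by unfold_locales (fact game, fact dag)
  show ?thesis
  proof (rule nash_policyI[OF limit_policy])
    fix i s c b assume c: "c \<in> contexts G E i" and b: "b \<in> acts G i"
    let ?w = "\<lambda>p. \<eta> * (visitation G (bn_policy G E p) s / (1 - disc G))"
    let ?\<sigma> = "\<lambda>t. softmax G (\<theta> t)"
    show "agent_q \<pi>\<^sub>s i s c b \<le> (\<Sum>b'\<in>acts G i. pmf (\<pi>\<^sub>s i s c) b' * agent_q \<pi>\<^sub>s i s c b')"
    \<comment> \<open>By the gradient formula the dynamics at a fixed agent, state and context is a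
      softmax ascent whose weight is the stepsize times visitation over
      \<open>1 - disc G\<close>.\<close>
    proof (rule softmax_ascent_limit[where x = "\<lambda>t. \<theta> t i s c" and \<sigma> = "\<lambda>t. pmf (?\<sigma> t i s c)"
          and h = "\<lambda>t. agent_q (?\<sigma> t) i s c" and w = "\<lambda>t. ?w (?\<sigma> t)" and w' = "?w \<pi>\<^sub>s" and B = "acts G i"])
      show "pmf (?\<sigma> t i s c) b = exp (\<theta> t i s c b) / (\<Sum>b'\<in>acts G i. exp (\<theta> t i s c b'))"
        if "b \<in> acts G i" for t b
        using that by (simp add: pmf_softmax[OF finite_acts acts_nonempty])
      show "\<theta> (Suc t) i s c b = \<theta> t i s c b + ?w (?\<sigma> t) * (pmf (?\<sigma> t i s c) b *
          (agent_q (?\<sigma> t) i s c b - (\<Sum>b'\<in>acts G i. pmf (?\<sigma> t i s c) b' * agent_q (?\<sigma> t) i s c b')))"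
        if "b \<in> acts G i" for t b
        using dynamics c that by (simp add: policy_gradient_dynamics_def partial_value_eq)
      show "(\<lambda>t. ?w (?\<sigma> t)) \<longlonglongrightarrow> ?w \<pi>\<^sub>s"
        using disc
        by (intro tendsto_intros tendsto_visitation joint_policy_bn tendsto_pmf_bn local_policy_softmax
              limit_policy limit) auto
      \<comment> \<open>Positivity of the limiting weight uses full visitation at the limit policy
        itself, which need not be a softmax policy.\<close>
      show "0 < ?w \<pi>\<^sub>s"
        using stepsize(1) disc visits[OF joint_policy_bn[OF limit_policy]] by simp
      show "(\<lambda>t. agent_q (?\<sigma> t) i s c b) \<longlonglongrightarrow> agent_q \<pi>\<^sub>s i s c b" for b
        by (rule tendsto_agent_q[OF local_policy_softmax limit_policy limit])
    qed (use finite_acts b limit[OF c] in auto)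
  qed
qed

end
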